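(* Fix an integer $p\geq 2$, a unit vector $\theta_1^0\in\mathbb{R}^p$, $v>0$ and a bounded positive real sequence $(r_n)$. Then, under $\mathrm{P}_{\theta_1^0,r_n,v}$, the statistic $Q_{\rm HPV}=Q_{\rm HPV}^{(n)}$ satisfies, as $n\to\infty$, $$Q_{\rm HPV}\stackrel{\mathcal D}{\to}\chi^2_{p-1},$$ so that, in each of the four regimes (i) $r_n\equiv 1$; (ii) $r_n=o(1)$ with $\sqrt{n}\,r_n\to\infty$; (iii) $r_n=1/\sqrt{n}$; (iv) $r_n=o(1/\sqrt{n})$, the test $\phi_{\rm HPV}$ has asymptotic size $\alpha$ under the null hypothesis (for any $\alpha\in(0,1)$), that is, its rejection probability under $\mathrm{P}_{\theta_1^0,r_n,v}$ converges to $\alpha$.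
   Context: Model: for a unit vector $\theta_1\in\mathbb{R}^p$, $v>0$ and a positive sequence $(r_n)$, $\mathrm{P}_{\theta_1,r_n,v}$ denotes the (sequence of) hypotheses under which, for each $n$, $X_{n1},\ldots,X_{nn}$ are i.i.d. $p$-variate normal with mean $0$ and covariance matrix $\Sigma_n=I_p+r_nv\,\theta_1\theta_1'$ (a triangular array; the dimension $p$ is fixed). Prime denotes transpose. Let $\bar X_n=\frac1n\sum_{i=1}^nX_{ni}$ and $S_n=\frac1n\sum_{i=1}^n(X_{ni}-\bar X_n)(X_{ni}-\bar X_n)'$. Let $\hat\lambda_{n1}\geq\cdots\geq\hat\lambda_{np}$ be the eigenvalues of $S_n$ and $\hat\theta_{nj}$ a unit eigenvector of $S_n$ associated with $\hat\lambda_{nj}$ (almost surely unique up to sign for $n>p$; the sign is irrelevant here). Test: the null hypothesis is $\mathcal{H}_0^{(n)}:\theta_1=\theta_1^0$ for the given unit vector $\theta_1^0$. Let $\tilde\theta_{n2},\ldots,\tilde\theta_{np}$ be obtained by Gram–Schmidt orthogonalization of $\theta_1^0,\hat\theta_{n2},\ldots,\hat\theta_{np}$, i.e. recursively for $j=2,\ldots,p$, $$\tilde\theta_{nj}=\frac{(I_p-\theta_1^0\theta_1^{0\prime}-\sum_{k=2}^{j-1}\tilde\theta_{nk}\tilde\theta_{nk}')\hat\theta_{nj}}{\|(I_p-\theta_1^0\theta_1^{0\prime}-\sum_{k=2}^{j-1}\tilde\theta_{nk}\tilde\theta_{nk}')\hat\theta_{nj}\|}$$ (an empty sum is zero). Then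 $$Q_{\rm HPV}=Q_{\rm HPV}^{(n)}=\frac{n}{\hat\lambda_{n1}}\sum_{j=2}^p\hat\lambda_{nj}^{-1}\big(\tilde\theta_{nj}'S_n\theta_1^0\big)^2,$$ and $\phi_{\rm HPV}$ rejects the null hypothesis at asymptotic level $\alpha$ when $Q_{\rm HPV}>\chi^2_{p-1,1-\alpha}$, where $\chi^2_{\ell,1-\alpha}$ is the $\alpha$-upper quantile of the chi-square distribution with $\ell$ degrees of freedom. $\stackrel{\mathcal D}{\to}$ denotes weak convergence. *)

theory Defs
  imports "HOL-Probability.Probability" "HOL-Library.Landau_Symbols"
begin

section \<open>Matrices and spectra\<close>

definition outer :: "real ^ 'p \<Rightarrow> real ^ 'p \<Rightarrow> real ^ 'p ^ 'p" where
  "outer x y = (\<chi> i j. x $ i * y $ j)"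

text \<open>
  The values \<open>l 1 \<ge> \<dots> \<ge> l p\<close> (indices start at 1) are the eigenvalues of \<open>A\<close>, repeated
  according to their multiplicity as roots of the characteristic polynomial.
\<close>
definition ordered_eigenvalues :: "real ^ 'p ^ 'p \<Rightarrow> (nat \<Rightarrow> real) \<Rightarrow> bool" where
  "ordered_eigenvalues A l \<longleftrightarrow>
     (\<forall>i j. 1 \<le> i \<and> i \<le> j \<and> j \<le> CARD('p) \<longrightarrow> l j \<le> l i) \<and>
     (\<forall>x. det (x *\<^sub>R mat 1 - A) = (\<Prod>j = 1..CARD('p). x - l j))"

definition unit_eigenvector :: "real ^ 'p ^ 'p \<Rightarrow> real \<Rightarrow> real ^ 'p \<Rightarrow> bool" where
  "unit_eigenvector A l u \<longleftrightarrow> norm u = 1 \<and> A *v u = l *\<^sub>R u"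


section \<open>The Gaussian triangular array\<close>

text \<open>Only used for a symmetric positive definite \<open>C\<close>.\<close>
definition mvn_density :: "real ^ 'p \<Rightarrow> real ^ 'p ^ 'p \<Rightarrow> real ^ 'p \<Rightarrow> real" where
  "mvn_density m C x =
     exp (- ((x - m) \<bullet> (matrix_inv C *v (x - m))) / 2) / sqrt ((2 * pi) ^ CARD('p) * det C)"

definition spiked_cov :: "real ^ 'p \<Rightarrow> real \<Rightarrow> real \<Rightarrow> real ^ 'p ^ 'p" where
  "spiked_cov \<theta> s v = mat 1 + (s * v) *\<^sub>R outer \<theta> \<theta>"

text \<open>
  The \<open>n\<close>-th row \<open>X n 1, \<dots>, X n n\<close> of the array may live on its own probability space \<open>M n\<close>.
  Rows are indexed by \<open>n \<ge> 1\<close>, and nothing is said about \<open>n = 0\<close>.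
\<close>
definition spiked_model ::
  "real ^ 'p \<Rightarrow> (nat \<Rightarrow> real) \<Rightarrow> real \<Rightarrow> (nat \<Rightarrow> 'a measure) \<Rightarrow> (nat \<Rightarrow> nat \<Rightarrow> 'a \<Rightarrow> real ^ 'p) \<Rightarrow> bool"
where
  "spiked_model \<theta> r v M X \<longleftrightarrow>
     (\<forall>n\<ge>1. prob_space (M n) \<and>
        prob_space.indep_vars (M n) (\<lambda>_. borel) (X n) {1..n} \<and>
        (\<forall>i\<in>{1..n}. distributed (M n) lborel (X n i)
           (\<lambda>x. ennreal (mvn_density 0 (spiked_cov \<theta> (r n) v) x))))"

definition sample_mean :: "nat \<Rightarrow> (nat \<Rightarrow> real ^ 'p) \<Rightarrow> real ^ 'p" where
  "sample_mean n x = (1 / real n) *\<^sub>R (\<Sum>i = 1..n. x i)"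

definition sample_cov :: "nat \<Rightarrow> (nat \<Rightarrow> real ^ 'p) \<Rightarrow> real ^ 'p ^ 'p" where
  "sample_cov n x =
     (1 / real n) *\<^sub>R (\<Sum>i = 1..n. outer (x i - sample_mean n x) (x i - sample_mean n x))"


section \<open>The test statistic\<close>

text \<open>
  Gram--Schmidt orthogonalization of \<open>\<theta>0, u 2, u 3, \<dots>\<close>; meaningful for indices \<open>j \<ge> 2\<close> only.
\<close>
fun gs_vec :: "real ^ 'p \<Rightarrow> (nat \<Rightarrow> real ^ 'p) \<Rightarrow> nat \<Rightarrow> real ^ 'p" where
  "gs_vec \<theta>0 u j =
     (let w = (mat 1 - outer \<theta>0 \<theta>0
                - (\<Sum>k\<in>{2..<j}. outer (gs_vec \<theta>0 u k) (gs_vec \<theta>0 u k))) *v u j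
      in (1 / norm w) *\<^sub>R w)"

declare gs_vec.simps [simp del]

definition Q_HPV ::
  "real ^ 'p \<Rightarrow> nat \<Rightarrow> real ^ 'p ^ 'p \<Rightarrow> (nat \<Rightarrow> real) \<Rightarrow> (nat \<Rightarrow> real ^ 'p) \<Rightarrow> real" where
  "Q_HPV \<theta>0 n S l u =
     real n / l 1 * (\<Sum>j = 2..CARD('p). inverse (l j) * (gs_vec \<theta>0 u j \<bullet> (S *v \<theta>0))\<^sup>2)"


section \<open>The chi-square distribution\<close>

definition chi_square :: "nat \<Rightarrow> real measure" where
  "chi_square k =
     distr (PiM {..<k} (\<lambda>_. std_normal_distribution)) borel (\<lambda>z. \<Sum>i<k. (z i)\<^sup>2)"

text \<open>The \<open>\<alpha>\<close>-upper quantile, i.e. the quantile of order \<open>1 - \<alpha>\<close>.\<close>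
definition chi_square_upper_quantile :: "nat \<Rightarrow> real \<Rightarrow> real" where
  "chi_square_upper_quantile k \<alpha> = Inf {x. 1 - \<alpha> \<le> cdf (chi_square k) x}"

end

theory Submission
  imports Defs
begin

text \<open>
  Write \<open>P = I - \<theta> \<theta>'\<close> for the projection onto the complement of the null direction \<open>\<theta> = \<theta>0\<close>. If the
  Gram--Schmidt vectors form an orthonormal basis of that complement, the sum of the squares of their
  inner products with \<open>S \<theta>\<close> is \<open>\<parallel>P S \<theta>\<parallel>\<^sup>2\<close>, whichever basis it is. So the limiting behaviour of the
  sample eigenvectors, which depends on the regime of \<open>r\<close> and may fail to exist, is irrelevant: up to
  the weights given by the eigenvalues, the test statistic is

    \<open>T = n \<parallel>P S \<theta>\<parallel>\<^sup>2 / (\<theta> \<bullet> S \<theta>)\<close>.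

  This \<open>T\<close> has the chi-square law exactly (\<open>exact_statistic_law\<close>). Indeed, let \<open>a\<close> be the centred vector of
  the \<open>\<theta>\<close>-coordinates of the sample. Then \<open>\<theta> \<bullet> S \<theta> = \<parallel>a\<parallel>\<^sup>2 / n\<close> and \<open>P S \<theta>\<close> is \<open>1 / n\<close> times the sum of
  the \<open>P X i\<close> with weights \<open>a i\<close>. Given \<open>a\<close>, the vector \<open>(\<Sum>i. a i P X i) / \<parallel>a\<parallel>\<close> is standard normal on the
  complement, because under the null hypothesis the \<open>P X i\<close> are standard normal and independent of \<open>a\<close>.
  The spike strength cancels.

  The ratio of the two statistics tends to \<open>1\<close> in probability (\<open>HPV_sandwich\<close>). Chebyshev's inequality
  makes \<open>S\<close> close to the covariance \<open>I + \<rho> \<theta> \<theta>'\<close>, where \<open>\<rho> = r n * v\<close> (\<open>prob_not_concentrated\<close>,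
  \<open>concentrated_sample_cov_close\<close>); hence the first eigenvalue is close to \<open>1 + \<rho>\<close>, as is \<open>\<theta> \<bullet> S \<theta>\<close>,
  and the others are close to \<open>1\<close>. A squeeze of distribution functions gives the weak convergence, and
  since the chi-square law has no atoms the rejection probability converges to \<open>\<alpha>\<close>.

  There remains an almost sure statement: the eigenvalues of \<open>S\<close> are distinct, so that the eigenvectors
  are orthonormal, and the Gram--Schmidt recursion does not degenerate. Both follow if \<open>\<theta>\<close> is a cyclic
  vector of \<open>S\<close>. This means that a certain polynomial in the Gaussian coordinates does not vanish, and a
  polynomial which is nonzero at one point is nonzero almost everywhere (\<open>AE_polynomial_nonzero\<close>). Such a
  point is supplied by a sample with a tridiagonal covariance matrix (\<open>cyclic_sample_exists\<close>).
\<close>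

section \<open>Symmetric matrices with a cyclic vector\<close>

lemma symmetric_dot_commute:
  fixes S :: "real ^ 'p ^ 'p"
  assumes "transpose S = S"
  shows "(S *v x) \<bullet> y = x \<bullet> (S *v y)"
  by (metis assms dot_lmul_matrix transpose_matrix_vector)

text \<open>
A maximizer \<open>u\<close> of the Rayleigh quotient over the unit sphere of \<open>V\<close> is an eigenvector: the
residual \<open>S u - m u\<close> lies in \<open>V\<close>, and the first-order condition makes it orthogonal to \<open>V\<close>.
\<close>
lemma symmetric_eigenvector_in_invariant_subspace:
  fixes S :: "real ^ 'p ^ 'p"
  assumes sym: "transpose S = S" and V: "subspace V" and inv: "\<And>x. x \<in> V \<Longrightarrow> S *v x \<in> V"
    and a: "a \<in> V" "a \<noteq> 0"
  obtains u m where "u \<in> V" "u \<noteq> 0" "S *v u = m *\<^sub>R u"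
proof -
  let ?K = "V \<inter> sphere 0 1" and ?f = "\<lambda>x. x \<bullet> (S *v x)"
  have "compact ?K"
    by (intro closed_Int_compact closed_subspace V compact_sphere)
  moreover have "inverse (norm a) *\<^sub>R a \<in> ?K"
    using a V by (auto simp: subspace_scale)
  moreover have "continuous_on ?K ?f"
    by (intro continuous_intros linear_continuous_on matrix_vector_mul_bounded_linear)
  ultimately obtain u where u: "u \<in> ?K" and umax: "\<And>y. y \<in> ?K \<Longrightarrow> ?f y \<le> ?f u"
    using continuous_attains_sup[of ?K ?f] by blast
  define m where "m = ?f u"
  have uV: "u \<in> V" and uu: "u \<bullet> u = 1"
    using u by (auto simp: dot_square_norm)
  have rayleigh: "?f y \<le> m * (y \<bullet> y)" if "y \<in> V" for y
  proof (cases "y = 0")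
    case False
    have "inverse (norm y) *\<^sub>R y \<in> ?K"
      using that V False by (auto simp: subspace_scale)
    from umax[OF this] have "?f y / (norm y)^2 \<le> m"
      by (simp add: m_def matrix_vector_mult_scaleR power2_eq_square divide_inverse mult.commute mult.left_commute)
    then show ?thesis
      using False by (simp add: divide_le_eq dot_square_norm)
  qed simp
  have stat: "(S *v u - m *\<^sub>R u) \<bullet> y = 0" if y: "y \<in> V" for y
  proof (rule ccontr)
    define b where "b = m * (u \<bullet> y) - (S *v u) \<bullet> y"
    define c where "c = m * (y \<bullet> y) - ?f y"
    assume "(S *v u - m *\<^sub>R u) \<bullet> y \<noteq> 0"
    then have b: "b \<noteq> 0" by (simp add: b_def algebra_simps)
    have c: "c \<ge> 0" using rayleigh[OF y] by (simp add: c_def)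
    have q: "0 \<le> 2 * t * b + t^2 * c" for t
    proof -
      have "u + t *\<^sub>R y \<in> V" using uV y V by (simp add: subspace_add subspace_scale)
      from rayleigh[OF this] show ?thesis
        using uu symmetric_dot_commute[OF sym, of u y]
        by (simp add: b_def c_def m_def matrix_vector_right_distrib matrix_vector_mult_scaleR
            algebra_simps inner_commute power2_eq_square)
    qed
    \<comment> \<open>The quadratic \<open>2 t b + t\<^sup>2 c\<close> is negative at this \<open>t\<close>; the minimizer \<open>- b / c\<close> is avoided
      because \<open>c\<close> may vanish.\<close>
    define t where "t = - b / (c + 1)"
    have "2 * t * b + t^2 * c = - (b^2 * (c + 2)) / (c+1)^2"
      using c by (simp add: t_def divide_simps power2_eq_square) (simp add: algebra_simps)
    also have "\<dots> < 0"
      using b c by (simp add: divide_neg_pos)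
    finally show False using q[of t] by simp
  qed
  have "S *v u - m *\<^sub>R u \<in> V"
    using uV inv V by (simp add: subspace_diff subspace_scale)
  from stat[OF this] have "S *v u = m *\<^sub>R u" by simp
  moreover have "u \<noteq> 0" using uu by auto
  ultimately show ?thesis using uV that by blast
qed

text \<open>
The orthogonal complement of all eigenvectors is invariant, so if it were nonzero it would contain
an eigenvector.
\<close>
lemma symmetric_eigenvectors_span:
  fixes S :: "real ^ 'p ^ 'p"
  assumes sym: "transpose S = S"
  shows "span {u. \<exists>m. S *v u = m *\<^sub>R u} = UNIV"
proof (rule ccontr)
  let ?E = "{u. \<exists>m. S *v u = m *\<^sub>R u}"
  assume "span ?E \<noteq> UNIV"
  then obtain a where a: "a \<noteq> 0" "span ?E \<subseteq> {x. a \<bullet> x = 0}"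
    using span_not_univ_subset_hyperplane by blast
  define V where "V = {x. \<forall>u\<in>?E. u \<bullet> x = 0}"
  have "subspace V"
    by (auto simp: V_def subspace_def inner_add_right)
  moreover have "S *v x \<in> V" if "x \<in> V" for x
  proof -
    have "u \<bullet> (S *v x) = 0" if "S *v u = m *\<^sub>R u" for u m
      using that \<open>x \<in> V\<close> symmetric_dot_commute[OF sym, of u x] by (auto simp: V_def)
    then show ?thesis unfolding V_def by blast
  qed
  moreover have "a \<in> V"
    using a(2) span_superset[of ?E] by (auto simp: V_def inner_commute)
  ultimately obtain u m where "u \<in> V" "u \<noteq> 0" "S *v u = m *\<^sub>R u"
    using a(1) symmetric_eigenvector_in_invariant_subspace[OF sym] by metis
  then show False by (auto simp: V_def)
qed

text \<open>
Cyclicity is the one genericity condition behind the test statistic. For symmetric \<open>S\<close> it says that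
no eigenvector is orthogonal to \<open>\<theta>\<close>, which rules out repeated eigenvalues (two eigenvectors for the
same eigenvalue could be combined into one orthogonal to \<open>\<theta>\<close>) and keeps the Gram--Schmidt recursion
from dividing by zero. Unlike those consequences, it is visibly the nonvanishing of a polynomial in
the entries of \<open>S\<close>, the determinant in \<open>cyclic_vector_iff_det\<close>.
\<close>
definition cyclic_vector :: "real ^ 'p ^ 'p \<Rightarrow> real ^ 'p \<Rightarrow> bool" where
  "cyclic_vector S \<theta> \<longleftrightarrow> span ((\<lambda>k. (((*v) S) ^^ k) \<theta>) ` {..<CARD('p)}) = UNIV"

lemma cyclic_vector_iff_det:
  fixes S :: "real ^ 'p ^ 'p"
  assumes "bij_betw \<iota> (UNIV :: 'p set) {..<CARD('p)}"
  shows "cyclic_vector S \<theta> \<longleftrightarrow> det (\<chi> i. (((*v) S) ^^ \<iota> i) \<theta>) \<noteq> 0"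
proof -
  let ?K = "(\<chi> i. (((*v) S) ^^ \<iota> i) \<theta>) :: real ^ 'p ^ 'p"
  have "rows ?K = (\<lambda>i. (((*v) S) ^^ \<iota> i) \<theta>) ` UNIV"
    by (auto simp: rows_def row_def)
  also have "\<dots> = (\<lambda>k. (((*v) S) ^^ k) \<theta>) ` (\<iota> ` UNIV)"
    by (simp only: image_image)
  also have "\<iota> ` UNIV = {..<CARD('p)}"
    using assms by (simp add: bij_betw_def)
  finally have rows: "rows ?K = (\<lambda>k. (((*v) S) ^^ k) \<theta>) ` {..<CARD('p)}" .
  have "span (rows ?K) = UNIV \<longleftrightarrow> det ?K \<noteq> 0"
    by (simp only: invertible_det_nz[symmetric] invertible_left_inverse matrix_left_invertible_span_rows)
  then show ?thesis
    by (simp only: cyclic_vector_def rows)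
qed

lemma cyclic_eigenvector_not_orthogonal:
  fixes S :: "real ^ 'p ^ 'p"
  assumes sym: "transpose S = S" and cyc: "cyclic_vector S \<theta>"
    and u: "S *v u = m *\<^sub>R u" "u \<noteq> 0"
  shows "u \<bullet> \<theta> \<noteq> 0"
proof
  assume *: "u \<bullet> \<theta> = 0"
  have pow: "u \<bullet> (((*v) S) ^^ k) \<theta> = 0" for k
  proof (induction k)
    case (Suc k)
    then show ?case
      using symmetric_dot_commute[OF sym, of u "(((*v) S) ^^ k) \<theta>"] u by simp
  qed (use * in simp)
  have "orthogonal u x" if "x \<in> span ((\<lambda>k. (((*v) S) ^^ k) \<theta>) ` {..<CARD('p)})" for x
    by (rule orthogonal_to_span[OF that]) (auto simp: orthogonal_def pow)
  then have "orthogonal u u"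
    using cyc by (simp add: cyclic_vector_def)
  then show False using u by (simp add: orthogonal_def)
qed

lemma eigenvalue_mem_ordered:
  fixes S :: "real ^ 'p ^ 'p"
  assumes "ordered_eigenvalues S l" "S *v u = m *\<^sub>R u" "u \<noteq> 0"
  shows "m \<in> l ` {1..CARD('p)}"
proof -
  have "(m *\<^sub>R mat 1 - S) *v u = 0"
    using assms(2) by (simp add: matrix_vector_mult_diff_rdistrib scaleR_matrix_vector_assoc[symmetric])
  then have "\<not> (\<exists>B. B ** (m *\<^sub>R mat 1 - S) = mat 1)"
    using assms(3) by (auto simp: matrix_left_invertible_ker)
  then have "det (m *\<^sub>R mat 1 - S) = 0"
    using invertible_det_nz invertible_left_inverse by blast
  then have "(\<Prod>j = 1..CARD('p). m - l j) = 0"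
    using assms(1) by (simp add: ordered_eigenvalues_def)
  then show ?thesis by auto
qed

text \<open>
A basis of eigenvectors carries \<open>CARD('p)\<close> distinct eigenvalues, each of which is a root of the
characteristic polynomial and therefore one of the \<open>l j\<close>; so the \<open>l j\<close> have to be distinct.
\<close>
lemma cyclic_imp_simple_spectrum:
  fixes S :: "real ^ 'p ^ 'p"
  assumes sym: "transpose S = S" and cyc: "cyclic_vector S \<theta>"
    and l: "ordered_eigenvalues S l"
  shows "inj_on l {1..CARD('p)}"
proof -
  let ?E = "{u. \<exists>m. S *v u = m *\<^sub>R u}"
  obtain B where B: "B \<subseteq> ?E" "independent B" "?E \<subseteq> span B" "card B = dim ?E"
    by (rule basis_exists)
  have cardB: "card B = CARD('p)"
    using B(4) symmetric_eigenvectors_span[OF sym] dim_span[of ?E]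
    by (simp only: dim_UNIV DIM_cart DIM_real mult_1_right)
  obtain \<mu> where \<mu>: "\<And>b. b \<in> B \<Longrightarrow> S *v b = \<mu> b *\<^sub>R b"
  proof -
    have "\<forall>b\<in>B. \<exists>m. S *v b = m *\<^sub>R b" using B(1) by blast
    then show ?thesis using that by (rule bchoice[THEN exE]) blast
  qed
  have nz: "b \<noteq> 0" if "b \<in> B" for b
    using B(2) that dependent_zero by blast
  have "inj_on \<mu> B"
  proof (rule inj_onI, rule ccontr)
    fix b c assume bc: "b \<in> B" "c \<in> B" "\<mu> b = \<mu> c" "b \<noteq> c"
    \<comment> \<open>The combination of the two eigenvectors that is orthogonal to the cyclic vector must
      vanish, which contradicts linear independence.\<close>
    define x where "x = (c \<bullet> \<theta>) *\<^sub>R b - (b \<bullet> \<theta>) *\<^sub>R c"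
    have "S *v x = \<mu> b *\<^sub>R x"
      using bc \<mu> by (simp add: x_def matrix_vector_mult_diff_distrib matrix_vector_mult_scaleR
          scaleR_diff_right mult.commute)
    moreover have "x \<bullet> \<theta> = 0" by (simp add: x_def inner_diff_left)
    ultimately have "x = 0"
      using cyclic_eigenvector_not_orthogonal[OF sym cyc] by blast
    moreover have "c \<bullet> \<theta> \<noteq> 0"
      using cyclic_eigenvector_not_orthogonal[OF sym cyc \<mu>[OF bc(2)] nz[OF bc(2)]] .
    moreover have "b = inverse (c \<bullet> \<theta>) *\<^sub>R ((c \<bullet> \<theta>) *\<^sub>R b)"
      using \<open>c \<bullet> \<theta> \<noteq> 0\<close> by simp
    ultimately have "b = (inverse (c \<bullet> \<theta>) * (b \<bullet> \<theta>)) *\<^sub>R c"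
      by (simp add: x_def)
    then have "b \<in> span (B - {b})"
      using bc by (metis insertE insert_Diff span_base span_scale)
    then show False using B(2) bc(1) dependent_def by blast
  qed
  then have "CARD('p) = card (\<mu> ` B)" by (simp add: card_image cardB)
  also have "\<dots> \<le> card (l ` {1..CARD('p)})"
    by (intro card_mono) (use eigenvalue_mem_ordered[OF l \<mu> nz] in auto)
  finally show ?thesis
    by (intro eq_card_imp_inj_on) (auto intro!: antisym card_image_le[of "{1..CARD('p)}", simplified])
qed

section \<open>The test statistic as a function of the covariance matrix\<close>

lemma orthonormal_expand:
  fixes e :: "'i \<Rightarrow> 'a :: euclidean_space"
  assumes "finite J" "card J = DIM('a)"
    and on: "\<And>i j. i \<in> J \<Longrightarrow> j \<in> J \<Longrightarrow> e i \<bullet> e j = (if i = j then 1 else 0)"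
  shows "(\<Sum>j\<in>J. (e j \<bullet> x) *\<^sub>R e j) = x"
proof -
  have inj: "inj_on e J"
    by (rule inj_onI) (metis on zero_neq_one)
  have pw: "pairwise orthogonal (e ` J)"
    using on by (auto simp: pairwise_def orthogonal_def)
  have nm: "norm i = 1" if "i \<in> e ` J" for i
    using that on by (auto simp: norm_eq_1)
  have "independent (e ` J)"
    using pw nm by (intro pairwise_orthogonal_independent) force+
  then have "span (e ` J) = UNIV"
    using assms inj by (intro card_ge_dim_independent[of _ UNIV, simplified, THEN top_le])
      (auto simp: card_image dim_UNIV)
  then have "(\<Sum>i\<in>e ` J. (x \<bullet> i) *\<^sub>R i) = x"
    using assms by (intro orthonormal_basis_expand pw nm) auto
  then show ?thesis
    by (simp add: sum.reindex[OF inj] inner_commute)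
qed

lemma orthonormal_parseval:
  fixes e :: "'i \<Rightarrow> 'a :: euclidean_space"
  assumes "finite J" "card J = DIM('a)"
    and on: "\<And>i j. i \<in> J \<Longrightarrow> j \<in> J \<Longrightarrow> e i \<bullet> e j = (if i = j then 1 else 0)"
  shows "(\<Sum>j\<in>J. (e j \<bullet> x) * (e j \<bullet> y)) = x \<bullet> y"
proof -
  have "x \<bullet> y = (\<Sum>j\<in>J. (e j \<bullet> x) *\<^sub>R e j) \<bullet> y"
    using orthonormal_expand[OF assms, where x = x] by simp
  then show ?thesis by (simp add: inner_sum_left)
qed

lemma outer_mult_vec: "outer x y *v z = (y \<bullet> z) *\<^sub>R x"
  by (simp add: vec_eq_iff outer_def matrix_vector_mult_def inner_vec_def sum_distrib_left
      sum_distrib_right mult_ac)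

lemma sum_matrix_mult_vec:
  fixes A :: "'i \<Rightarrow> real ^ 'm ^ 'n"
  shows "(\<Sum>k\<in>K. A k) *v x = (\<Sum>k\<in>K. A k *v x)"
  by (induction K rule: infinite_finite_induct) (auto simp: matrix_vector_mult_add_rdistrib)

lemma gs_vec_eq:
  "gs_vec \<theta> u j =
     (let w = u j - (\<theta> \<bullet> u j) *\<^sub>R \<theta> - (\<Sum>k\<in>{2..<j}. (gs_vec \<theta> u k \<bullet> u j) *\<^sub>R gs_vec \<theta> u k)
      in (1 / norm w) *\<^sub>R w)"
  by (subst gs_vec.simps)
    (simp add: Let_def matrix_vector_mult_diff_rdistrib outer_mult_vec sum_matrix_mult_vec)

text \<open>
The recursion never degenerates: a vanishing residual would put \<open>u j\<close> into the span of
\<open>\<theta>, u 2, \<dots>, u (j - 1)\<close>. Pairing with \<open>u 1\<close>, which is orthogonal to every \<open>u k\<close> but not to \<open>\<theta>\<close>,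
shows that \<open>\<theta>\<close> does not enter this combination, and then \<open>u j\<close> would be orthogonal to itself.
\<close>
lemma gs_vec_orthonormal_step:
  assumes \<theta>: "norm \<theta> = 1"
    and u: "\<And>i j. i \<in> {1..p} \<Longrightarrow> j \<in> {1..p} \<Longrightarrow> u i \<bullet> u j = (if i = j then 1 else 0)"
    and u1: "u 1 \<bullet> \<theta> \<noteq> 0"
    and j: "2 \<le> j" "j \<le> p"
  shows "gs_vec \<theta> u j \<bullet> gs_vec \<theta> u j = 1 \<and> gs_vec \<theta> u j \<bullet> \<theta> = 0 \<and>
    (\<forall>k\<in>{2..<j}. gs_vec \<theta> u j \<bullet> gs_vec \<theta> u k = 0) \<and>
    gs_vec \<theta> u j \<in> span (insert \<theta> (u ` {2..j}))"
  using j
proof (induction j rule: less_induct)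
  case (less j)
  let ?g = "gs_vec \<theta> u"
  define w where "w = u j - (\<theta> \<bullet> u j) *\<^sub>R \<theta> - (\<Sum>k\<in>{2..<j}. (?g k \<bullet> u j) *\<^sub>R ?g k)"
  have g: "?g j = (1 / norm w) *\<^sub>R w"
    by (subst gs_vec_eq) (simp add: w_def Let_def)
  have \<theta>\<theta>: "\<theta> \<bullet> \<theta> = 1" using \<theta> by (simp add: dot_square_norm)
  have IH: "?g k \<bullet> ?g k = 1" "?g k \<bullet> \<theta> = 0" "\<And>m. m \<in> {2..<k} \<Longrightarrow> ?g k \<bullet> ?g m = 0"
      "?g k \<in> span (insert \<theta> (u ` {2..k}))" if "k \<in> {2..<j}" for k
    using less.IH[of k] less.prems that by auto
  have gg: "?g k \<bullet> ?g m = (if k = m then 1 else 0)" if "k \<in> {2..<j}" "m \<in> {2..<j}" for k m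
    using IH(1)[OF that(1)] IH(3)[OF that(1), of m] IH(3)[OF that(2), of k] that
    by (cases k m rule: linorder_cases) (simp_all add: inner_commute[of "?g k" "?g m"])
  have w\<theta>: "w \<bullet> \<theta> = 0"
    using IH(2) by (simp add: w_def inner_diff_left inner_sum_left \<theta>\<theta> inner_commute[of \<theta> "u j"])
  have wg: "w \<bullet> ?g m = 0" if m: "m \<in> {2..<j}" for m
  proof -
    have "(\<Sum>k\<in>{2..<j}. (?g k \<bullet> u j) *\<^sub>R ?g k) \<bullet> ?g m = (\<Sum>k\<in>{2..<j}. (?g k \<bullet> u j) * (if k = m then 1 else 0))"
      unfolding inner_sum_left by (intro sum.cong) (use gg m in auto)
    also have "\<dots> = ?g m \<bullet> u j" using m by (simp add: sum.delta if_distrib cong: if_cong)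
    finally show ?thesis
      using IH(2)[OF m] by (simp add: w_def inner_diff_left inner_commute[of \<theta> "?g m"] inner_commute[of "?g m" "u j"])
  qed
  have span_old: "(\<theta> \<bullet> u j) *\<^sub>R \<theta> + (\<Sum>k\<in>{2..<j}. (?g k \<bullet> u j) *\<^sub>R ?g k) \<in> span (insert \<theta> (u ` {2..<j}))"
  proof (intro span_add span_sum span_scale)
    fix k assume k: "k \<in> {2..<j}"
    have "insert \<theta> (u ` {2..k}) \<subseteq> insert \<theta> (u ` {2..<j})" using k by auto
    then show "?g k \<in> span (insert \<theta> (u ` {2..<j}))"
      using IH(4)[OF k] span_mono by blast
  qed (auto intro: span_base)
  have "w \<noteq> 0"
  proof
    assume "w = 0"
    then have "u j \<in> span (insert \<theta> (u ` {2..<j}))"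
      using span_old by (simp add: w_def algebra_simps)
    then obtain a where a: "u j - a *\<^sub>R \<theta> \<in> span (u ` {2..<j})"
      using span_breakdown_eq by blast
    have orth: "orthogonal (u i) x" if "x \<in> span (u ` {2..<j})" "i = 1 \<or> i = j" for x i
      by (rule orthogonal_to_span[OF that(1)]) (use u less.prems that(2) in \<open>auto simp: orthogonal_def\<close>)
    have "a * (u 1 \<bullet> \<theta>) = 0"
      using orth[OF a, of 1] u[of 1 j] less.prems by (auto simp: orthogonal_def inner_diff_right)
    then have "a = 0" using u1 by simp
    then have "u j \<bullet> u j = 0"
      using orth[OF a, of j] by (simp add: orthogonal_def)
    then show False using u[of j j] less.prems by simp
  qed
  then have "?g j \<bullet> ?g j = 1"
    by (simp add: g dot_square_norm)
  moreover have "?g j \<in> span (insert \<theta> (u ` {2..j}))"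
  proof -
    have "w = u j - ((\<theta> \<bullet> u j) *\<^sub>R \<theta> + (\<Sum>k\<in>{2..<j}. (?g k \<bullet> u j) *\<^sub>R ?g k))"
      by (simp add: w_def)
    moreover have "insert \<theta> (u ` {2..<j}) \<subseteq> insert \<theta> (u ` {2..j})" by auto
    then have "(\<theta> \<bullet> u j) *\<^sub>R \<theta> + (\<Sum>k\<in>{2..<j}. (?g k \<bullet> u j) *\<^sub>R ?g k) \<in> span (insert \<theta> (u ` {2..j}))"
      using span_old span_mono by blast
    moreover have "u j \<in> span (insert \<theta> (u ` {2..j}))"
      using less.prems by (auto intro: span_base)
    ultimately have "w \<in> span (insert \<theta> (u ` {2..j}))" by (simp add: span_diff)
    then show ?thesis by (simp add: g span_scale)
  qed
  ultimately show ?case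
    using w\<theta> wg by (auto simp: g)
qed

text \<open>
Parseval's identity: \<open>\<theta>\<close> and the Gram--Schmidt vectors form an orthonormal basis. The right-hand side
does not depend on \<open>u\<close>, which is why the possible non-convergence of sample eigenvectors does no harm.
\<close>
lemma gs_vec_sum_squares:
  fixes \<theta> :: "real ^ 'p"
  assumes p: "CARD('p) \<ge> 2" and \<theta>: "norm \<theta> = 1"
    and u: "\<And>i j. i \<in> {1..CARD('p)} \<Longrightarrow> j \<in> {1..CARD('p)} \<Longrightarrow> u i \<bullet> u j = (if i = j then 1 else 0)"
    and u1: "u 1 \<bullet> \<theta> \<noteq> 0"
  shows "(\<Sum>j = 2..CARD('p). (gs_vec \<theta> u j \<bullet> x)\<^sup>2) = x \<bullet> x - (\<theta> \<bullet> x)\<^sup>2"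
proof -
  let ?h = "\<lambda>j. if j = 1 then \<theta> else gs_vec \<theta> u j"
  note step = gs_vec_orthonormal_step[OF \<theta> u u1]
  have lower: "?h i \<bullet> ?h j = 0" if "j < i" "1 \<le> j" "i \<le> CARD('p)" for i j
    using step[of i] that by auto
  have unit: "?h i \<bullet> ?h i = 1" if "i \<in> {1..CARD('p)}" for i
    using step[of i] that \<theta> dot_square_norm[of \<theta>] by (cases "i = 1") auto
  have on: "?h i \<bullet> ?h j = (if i = j then 1 else 0)" if ij: "i \<in> {1..CARD('p)}" "j \<in> {1..CARD('p)}" for i j
  proof (cases i j rule: linorder_cases)
    case less
    then show ?thesis
      using lower[OF less] ij inner_commute[of "?h i" "?h j"] by (auto split del: if_split)
  next
    case equal
    then show ?thesis using unit ij by (auto split del: if_split)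
  next
    case greater
    then show ?thesis using lower[OF greater] ij by (auto split del: if_split)
  qed
  have "x \<bullet> x = (\<Sum>j = 1..CARD('p). (?h j \<bullet> x)\<^sup>2)"
    using orthonormal_parseval[OF _ _ on, of "{1..CARD('p)}" x x] by (simp add: power2_eq_square)
  also have "{1..CARD('p)} = insert 1 {2..CARD('p)}" using p by auto
  finally show ?thesis by (simp add: if_distrib)
qed

text \<open>
The statistic with the eigenvalues \<open>l 1\<close> and \<open>l 2, l 3, \<dots>\<close> replaced by \<open>\<theta> \<bullet> (S *v \<theta>)\<close> and by \<open>1\<close>.
Under the null hypothesis it has the chi-square distribution exactly, for every sample size \<open>n \<ge> 2\<close>.
\<close>
definition exact_statistic :: "real ^ 'p \<Rightarrow> nat \<Rightarrow> real ^ 'p ^ 'p \<Rightarrow> real" where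
  "exact_statistic \<theta> n S = real n * ((S *v \<theta>) \<bullet> (S *v \<theta>) - (\<theta> \<bullet> (S *v \<theta>))\<^sup>2) / (\<theta> \<bullet> (S *v \<theta>))"

lemma unit_vector_orthogonal_in_plane:
  fixes \<theta> :: "'a :: real_inner"
  assumes "a \<bullet> a = 1" "b \<bullet> b = 1" "a \<bullet> b = 0"
  obtains s t :: real where "s\<^sup>2 + t\<^sup>2 = 1" "(s *\<^sub>R a + t *\<^sub>R b) \<bullet> \<theta> = 0"
proof (cases "a \<bullet> \<theta> = 0")
  case True
  then show ?thesis using that[of 1 0] by simp
next
  case False
  define r where "r = sqrt ((a \<bullet> \<theta>)\<^sup>2 + (b \<bullet> \<theta>)\<^sup>2)"
  have "(a \<bullet> \<theta>)\<^sup>2 + (b \<bullet> \<theta>)\<^sup>2 > 0"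
    using False by (simp add: sum_power2_gt_zero_iff)
  then have r: "r\<^sup>2 = (a \<bullet> \<theta>)\<^sup>2 + (b \<bullet> \<theta>)\<^sup>2" "r \<noteq> 0"
    unfolding r_def by (simp, metis less_irrefl real_sqrt_eq_zero_cancel_iff)
  show ?thesis
  proof (rule that[of "(b \<bullet> \<theta>) / r" "- (a \<bullet> \<theta>) / r"])
    have "((b \<bullet> \<theta>) / r)\<^sup>2 + (- (a \<bullet> \<theta>) / r)\<^sup>2 = ((a \<bullet> \<theta>)\<^sup>2 + (b \<bullet> \<theta>)\<^sup>2) / r\<^sup>2"
      by (simp add: power_divide add_divide_distrib)
    also have "\<dots> = 1"
      unfolding r(1)[symmetric] using r(2) by simp
    finally show "((b \<bullet> \<theta>) / r)\<^sup>2 + (- (a \<bullet> \<theta>) / r)\<^sup>2 = 1" .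
  qed (simp add: inner_diff_left)
qed

text \<open>
The eigenvalues only have to be located: \<open>l 1\<close> lies between \<open>\<theta> \<bullet> (S *v \<theta>)\<close> and \<open>1 + \<rho> + \<epsilon>\<close>, and
\<open>l 2, l 3, \<dots>\<close> lie in \<open>[1 - \<epsilon>, 1 + \<epsilon>]\<close>. As \<open>\<rho> \<ge> 0\<close>, the resulting factors do not depend on \<open>\<rho>\<close>, which is
what makes the conclusion uniform over spikes that vanish at any rate.
\<close>
lemma HPV_sandwich:
  fixes S :: "real ^ 'p ^ 'p"
  assumes p: "CARD('p) \<ge> 2" and \<theta>: "norm \<theta> = 1"
    and sym: "transpose S = S" and cyc: "cyclic_vector S \<theta>"
    and l: "ordered_eigenvalues S l"
    and u: "\<And>j. j \<in> {1..CARD('p)} \<Longrightarrow> unit_eigenvector S (l j) (u j)"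
    and \<rho>: "\<rho> \<ge> 0" and \<epsilon>: "0 \<le> \<epsilon>" "\<epsilon> < 1"
    and close: "\<And>x. norm x = 1 \<Longrightarrow> \<bar>x \<bullet> (S *v x) - (1 + \<rho> * (\<theta> \<bullet> x)\<^sup>2)\<bar> \<le> \<epsilon>"
  shows "0 \<le> exact_statistic \<theta> n S"
    and "Q_HPV \<theta> n S l u \<le> exact_statistic \<theta> n S / (1 - \<epsilon>)"
    and "(1 - \<epsilon>) / (1 + \<epsilon>)\<^sup>2 * exact_statistic \<theta> n S \<le> Q_HPV \<theta> n S l u"
proof -
  let ?p = "CARD('p)"
  have inj: "inj_on l {1..?p}" by (rule cyclic_imp_simple_spectrum[OF sym cyc l])
  have eig: "S *v u j = l j *\<^sub>R u j" "norm (u j) = 1" if "j \<in> {1..?p}" for j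
    using u[OF that] by (auto simp: unit_eigenvector_def)
  have on: "u i \<bullet> u j = (if i = j then 1 else 0)" if ij: "i \<in> {1..?p}" "j \<in> {1..?p}" for i j
  proof (cases "i = j")
    case False
    have "l i * (u i \<bullet> u j) = l j * (u i \<bullet> u j)"
      using symmetric_dot_commute[OF sym, of "u i" "u j"]
      unfolding eig(1)[OF ij(1)] eig(1)[OF ij(2)] by simp
    moreover have "l i \<noteq> l j" using inj_onD[OF inj _ ij] False by blast
    ultimately show ?thesis using False by simp
  next
    case True
    then show ?thesis using eig(2)[OF ij(1)] by (simp only: dot_square_norm) simp
  qed
  have one: "1 \<in> {1..?p}" using p by auto
  have u1: "u 1 \<bullet> \<theta> \<noteq> 0"
    using cyclic_eigenvector_not_orthogonal[OF sym cyc eig(1)[OF one]] eig(2)[OF one]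
    by (metis norm_zero zero_neq_one)
  have ord: "l j \<le> l i" if "1 \<le> i" "i \<le> j" "j \<le> ?p" for i j
    using l that by (auto simp: ordered_eigenvalues_def)
  define s where "s = \<theta> \<bullet> (S *v \<theta>)"
  define W where "W = (S *v \<theta>) \<bullet> (S *v \<theta>) - s\<^sup>2"
  have Wsum: "W = (\<Sum>j = 2..?p. (gs_vec \<theta> u j \<bullet> (S *v \<theta>))\<^sup>2)"
    using gs_vec_sum_squares[OF p \<theta> on u1] by (simp add: W_def s_def)
  have T: "exact_statistic \<theta> n S = real n * W / s"
    by (simp add: exact_statistic_def W_def s_def)
  have W0: "W \<ge> 0" unfolding Wsum by (intro sum_nonneg) auto
  have quad: "u j \<bullet> (S *v u j) = l j" if "j \<in> {1..?p}" for j
    using eig[OF that] by (simp add: dot_square_norm)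
  have l_low: "1 - \<epsilon> \<le> l j" if j: "j \<in> {1..?p}" for j
  proof -
    have "1 \<le> 1 + \<rho> * (\<theta> \<bullet> u j)\<^sup>2" using \<rho> by simp
    then show ?thesis
      using close[OF eig(2)[OF j]] quad[OF j] unfolding abs_le_iff by linarith
  qed
  have s_low: "1 + \<rho> - \<epsilon> \<le> s"
    using close[OF \<theta>] \<theta> by (simp add: s_def dot_square_norm abs_le_iff)
  have l1_up: "l 1 \<le> 1 + \<rho> + \<epsilon>"
  proof -
    have "\<bar>\<theta> \<bullet> u 1\<bar> \<le> 1" using Cauchy_Schwarz_ineq2[of \<theta> "u 1"] \<theta> eig(2)[OF one] by simp
    then have "(\<theta> \<bullet> u 1)\<^sup>2 \<le> 1" by (simp add: abs_square_le_1)
    then have "\<rho> * (\<theta> \<bullet> u 1)\<^sup>2 \<le> \<rho>" using \<rho> mult_left_le by blast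
    then show ?thesis
      using close[OF eig(2)[OF one]] quad[OF one] unfolding abs_le_iff by linarith
  qed
  have s_le_l1: "s \<le> l 1"
  proof -
    have "S *v \<theta> = (\<Sum>j = 1..?p. (l j * (u j \<bullet> \<theta>)) *\<^sub>R u j)"
    proof -
      have "\<theta> = (\<Sum>j = 1..?p. (u j \<bullet> \<theta>) *\<^sub>R u j)"
        using orthonormal_expand[OF _ _ on, of "{1..?p}" \<theta>] by simp
      then have "S *v \<theta> = S *v (\<Sum>j = 1..?p. (u j \<bullet> \<theta>) *\<^sub>R u j)" by simp
      also have "\<dots> = (\<Sum>j = 1..?p. (l j * (u j \<bullet> \<theta>)) *\<^sub>R u j)"
        by (subst linear_sum[OF matrix_vector_mul_linear])
          (auto intro!: sum.cong simp: matrix_vector_mult_scaleR eig mult.commute)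
      finally show ?thesis .
    qed
    then have "s = (\<Sum>j = 1..?p. l j * (u j \<bullet> \<theta>)\<^sup>2)"
      by (simp add: s_def inner_sum_right power2_eq_square inner_commute mult.assoc)
    also have "\<dots> \<le> (\<Sum>j = 1..?p. l 1 * (u j \<bullet> \<theta>)\<^sup>2)"
      by (intro sum_mono mult_right_mono) (auto intro: ord)
    also have "\<dots> = l 1 * (\<theta> \<bullet> \<theta>)"
      using orthonormal_parseval[OF _ _ on, of "{1..?p}" \<theta> \<theta>]
      by (simp add: power2_eq_square flip: sum_distrib_left)
    finally show ?thesis using \<theta> by (simp add: dot_square_norm)
  qed
  \<comment> \<open>A Courant--Fischer argument: the plane of the two leading eigenvectors contains a unit vector
    orthogonal to \<open>\<theta>\<close>, on which the population form takes the value \<open>1\<close>.\<close>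
  have l2_up: "l j \<le> 1 + \<epsilon>" if j: "j \<in> {2..?p}" for j
  proof -
    have two: "2 \<in> {1..?p}" using p by auto
    obtain a b :: real where ab: "a\<^sup>2 + b\<^sup>2 = 1" "(a *\<^sub>R u 1 + b *\<^sub>R u 2) \<bullet> \<theta> = 0"
      using unit_vector_orthogonal_in_plane[of "u 1" "u 2" \<theta>] on[OF one one] on[OF two two] on[OF one two]
      by auto
    let ?x = "a *\<^sub>R u 1 + b *\<^sub>R u 2"
    have xx: "?x \<bullet> ?x = 1"
      using on[OF one one] on[OF two two] on[OF one two] on[OF two one] ab(1)
      by (simp add: inner_add_left inner_add_right power2_eq_square)
    have "?x \<bullet> (S *v ?x) = a\<^sup>2 * l 1 + b\<^sup>2 * l 2"
      using on[OF one one] on[OF two two] on[OF one two] on[OF two one] eig(1)[OF one] eig(1)[OF two]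
      by (simp add: inner_add_left inner_add_right matrix_vector_right_distrib
          matrix_vector_mult_scaleR power2_eq_square)
    moreover have "a\<^sup>2 * l 2 \<le> a\<^sup>2 * l 1"
      using ord[of 1 2] p by (intro mult_left_mono) auto
    moreover have "a\<^sup>2 * l 2 + b\<^sup>2 * l 2 = l 2" using ab(1) by (metis distrib_right mult_1)
    moreover have "\<bar>?x \<bullet> (S *v ?x) - (1 + \<rho> * (\<theta> \<bullet> ?x)\<^sup>2)\<bar> \<le> \<epsilon>"
      using close[of ?x] xx by (simp add: norm_eq_1)
    moreover have "\<theta> \<bullet> ?x = 0" using ab(2) by (simp add: inner_commute)
    ultimately have "l 2 \<le> 1 + \<epsilon>" by simp
    then show ?thesis using ord[of 2 j] j by auto
  qed
  have s_pos: "s > 0" using s_low \<rho> \<epsilon> by linarith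
  have l1_pos: "l 1 > 0" using s_le_l1 s_pos by linarith
  show T0: "0 \<le> exact_statistic \<theta> n S" unfolding T using W0 s_pos by simp
  have Q: "Q_HPV \<theta> n S l u = real n / l 1 * (\<Sum>j = 2..?p. inverse (l j) * (gs_vec \<theta> u j \<bullet> (S *v \<theta>))\<^sup>2)"
    by (simp add: Q_HPV_def)
  have "(\<Sum>j = 2..?p. inverse (l j) * (gs_vec \<theta> u j \<bullet> (S *v \<theta>))\<^sup>2) \<le> (\<Sum>j = 2..?p. inverse (1 - \<epsilon>) * (gs_vec \<theta> u j \<bullet> (S *v \<theta>))\<^sup>2)"
    using l_low \<epsilon> by (intro sum_mono mult_right_mono le_imp_inverse_le) auto
  then have up: "(\<Sum>j = 2..?p. inverse (l j) * (gs_vec \<theta> u j \<bullet> (S *v \<theta>))\<^sup>2) \<le> W / (1 - \<epsilon>)"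
    by (simp add: Wsum divide_inverse_commute flip: sum_distrib_left)
  have lpos: "0 < l j" if "j \<in> {2..?p}" for j
    using l_low[of j] \<epsilon> that by auto
  have "(\<Sum>j = 2..?p. inverse (1 + \<epsilon>) * (gs_vec \<theta> u j \<bullet> (S *v \<theta>))\<^sup>2) \<le> (\<Sum>j = 2..?p. inverse (l j) * (gs_vec \<theta> u j \<bullet> (S *v \<theta>))\<^sup>2)"
    using l2_up lpos by (intro sum_mono mult_right_mono le_imp_inverse_le) auto
  then have low: "W / (1 + \<epsilon>) \<le> (\<Sum>j = 2..?p. inverse (l j) * (gs_vec \<theta> u j \<bullet> (S *v \<theta>))\<^sup>2)"
    by (simp add: Wsum divide_inverse_commute flip: sum_distrib_left)
  have "Q_HPV \<theta> n S l u \<le> real n / l 1 * (W / (1 - \<epsilon>))"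
    unfolding Q using up l1_pos by (intro mult_left_mono) auto
  also have "\<dots> \<le> real n / s * (W / (1 - \<epsilon>))"
    using s_le_l1 s_pos W0 \<epsilon> by (intro mult_right_mono divide_left_mono) auto
  finally show "Q_HPV \<theta> n S l u \<le> exact_statistic \<theta> n S / (1 - \<epsilon>)"
    by (simp add: T)
  have "(1 - \<epsilon>) * l 1 \<le> (1 - \<epsilon>) * (1 + \<rho> + \<epsilon>)" using l1_up \<epsilon> by (intro mult_left_mono) auto
  also have "\<dots> \<le> (1 + \<epsilon>) * (1 + \<rho> - \<epsilon>)"
    using mult_nonneg_nonneg[OF \<rho> \<epsilon>(1)] by (simp add: algebra_simps)
  also have "\<dots> \<le> (1 + \<epsilon>) * s" using s_low \<epsilon> by (intro mult_left_mono) auto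
  finally have ratio: "(1 - \<epsilon>) / (1 + \<epsilon>) / s \<le> 1 / l 1"
    using s_pos l1_pos \<epsilon> by (simp add: divide_simps mult.commute)
  have "(1 - \<epsilon>) / (1 + \<epsilon>)\<^sup>2 * exact_statistic \<theta> n S = ((1 - \<epsilon>) / (1 + \<epsilon>) / s) * (real n * (W / (1 + \<epsilon>)))"
    by (simp add: T power2_eq_square)
  also have "\<dots> \<le> 1 / l 1 * (real n * (W / (1 + \<epsilon>)))"
    using W0 \<epsilon> by (intro mult_right_mono ratio) auto
  also have "\<dots> = real n / l 1 * (W / (1 + \<epsilon>))" by simp
  also have "\<dots> \<le> Q_HPV \<theta> n S l u"
    unfolding Q using low l1_pos by (intro mult_left_mono) auto
  finally show "(1 - \<epsilon>) / (1 + \<epsilon>)\<^sup>2 * exact_statistic \<theta> n S \<le> Q_HPV \<theta> n S l u" .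
qed

section \<open>A sample with a cyclic covariance matrix\<close>

lemma sample_cov_mult_vec:
  "sample_cov n x *v y =
     (1 / real n) *\<^sub>R (\<Sum>i = 1..n. ((x i - sample_mean n x) \<bullet> y) *\<^sub>R (x i - sample_mean n x))"
  by (simp add: sample_cov_def sum_matrix_mult_vec outer_mult_vec flip: scaleR_matrix_vector_assoc)

lemma transpose_sample_cov: "transpose (sample_cov n x) = sample_cov n x"
  by (simp add: sample_cov_def transpose_def outer_def vec_eq_iff mult.commute)

text \<open>
With respect to the frame \<open>e\<close> the vectors \<open>e 0, e 0 + e 1, e 1 + e 2, \<dots>\<close> have a Jacobi (tridiagonal)
second moment matrix with nonzero off-diagonal entries, and the last basis vector of a Jacobi matrix
is cyclic: each application of the matrix reaches one basis vector further. Taking every vector with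
both signs makes the sample mean vanish, whence the requirement \<open>2 * CARD('p) \<le> n\<close>; the remaining
observations are zero.
\<close>
lemma cyclic_sample_exists:
  fixes e :: "nat \<Rightarrow> real ^ 'p"
  assumes on: "\<And>i j. i < CARD('p) \<Longrightarrow> j < CARD('p) \<Longrightarrow> e i \<bullet> e j = (if i = j then 1 else 0)"
    and n: "2 * CARD('p) \<le> n"
  obtains x where "cyclic_vector (sample_cov n x) (e (CARD('p) - 1))"
proof -
  let ?p = "CARD('p)"
  define y where "y k = e k + (if k = 0 then 0 else e (k - 1))" for k
  define x where "x i = (if 2 * ?p < i \<or> i = 0 then 0 else if odd i then y (i div 2) else - y (i div 2 - 1))" for i
  have p0: "0 < ?p" by simp
  have n0: "real n > 0" using n p0 by linarith
  have pairs: "(\<Sum>i = 1..2 * m. F (x i)) = (\<Sum>k<m. F (y k) + F (- y k))" if "m \<le> ?p"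
    for m and F :: "real ^ 'p \<Rightarrow> real ^ 'p"
    using that
  proof (induction m)
    case (Suc m)
    have "x (Suc (2 * m)) = y m" "x (Suc (Suc (2 * m))) = - y m"
      using Suc.prems by (auto simp: x_def)
    then show ?case using Suc by (simp add: add.assoc)
  qed simp
  have sumF: "(\<Sum>i = 1..n. F (x i)) = (\<Sum>k<?p. F (y k) + F (- y k))" if "F 0 = 0" for F :: "real ^ 'p \<Rightarrow> real ^ 'p"
  proof -
    have "(\<Sum>i = 1..n. F (x i)) = (\<Sum>i = 1..2 * ?p. F (x i))"
      using n that by (intro sum.mono_neutral_right) (auto simp: x_def)
    then show ?thesis using pairs[of ?p F] by simp
  qed
  have mean: "sample_mean n x = 0"
    using sumF[of "\<lambda>z. z"] by (simp add: sample_mean_def)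
  let ?S = "sample_cov n x"
  have S: "?S *v z = (2 / real n) *\<^sub>R (\<Sum>k<?p. (y k \<bullet> z) *\<^sub>R y k)" for z
    using sumF[of "\<lambda>w. (w \<bullet> z) *\<^sub>R w"]
    by (simp add: sample_cov_mult_vec mean scaleR_sum_right flip: scaleR_2)
  have down: "e (j - 1) = (real n / 2) *\<^sub>R (?S *v e j) - e j - (if Suc j < ?p then e (Suc j) + e j else 0)"
    if j: "0 < j" "j < ?p" for j
  proof -
    have "y k \<bullet> e j = (if k = j then 1 else 0) + (if k = Suc j then 1 else 0)" if "k < ?p" for k
      using on[OF that j(2)] on[of "k - 1" j] that j by (auto simp: y_def inner_add_left)
    then have "(\<Sum>k<?p. (y k \<bullet> e j) *\<^sub>R y k) =
        (\<Sum>k<?p. (if k = j then y k else 0) + (if k = Suc j then y k else 0))"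
      by (intro sum.cong) auto
    also have "\<dots> = y j + (if Suc j < ?p then y (Suc j) else 0)"
      using j by (simp add: sum.distrib)
    finally have "(real n / 2) *\<^sub>R (?S *v e j) = y j + (if Suc j < ?p then y (Suc j) else 0)"
      using n0 by (simp add: S)
    then show ?thesis using j by (auto simp: y_def)
  qed
  define U where "U m = span ((\<lambda>k. (((*v) ?S) ^^ k) (e (?p - 1))) ` {..m})" for m
  have U_mono: "U m \<subseteq> U (Suc m)" for m unfolding U_def by (intro span_mono) auto
  have SU: "?S *v z \<in> U (Suc m)" if "z \<in> U m" for z m
    using that unfolding U_def
  proof (induction rule: span_induct_alt)
    case base then show ?case by (simp add: span_zero)
  next
    case (step c a b)
    then obtain k where "k \<le> m" "a = (((*v) ?S) ^^ k) (e (?p - 1))" by auto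
    then have "?S *v a \<in> (\<lambda>k. (((*v) ?S) ^^ k) (e (?p - 1))) ` {..Suc m}"
      by (intro image_eqI[of _ _ "Suc k"]) auto
    then show ?case using step
      by (simp only: matrix_vector_right_distrib matrix_vector_mult_scaleR)
        (intro span_add span_scale, rule span_base)
  qed
  have U0: "e (?p - 1) \<in> U m" for m unfolding U_def by (intro span_base image_eqI[of _ _ 0]) auto
  \<comment> \<open>The three-term recurrence \<open>down\<close> recovers \<open>e (j - 1)\<close> from \<open>S e j\<close>, \<open>e j\<close> and \<open>e (j + 1)\<close>.\<close>
  have eU: "\<forall>i\<le>m. e (?p - 1 - i) \<in> U m" if "m < ?p" for m
    using that
  proof (induction m)
    case (Suc m)
    then have IH: "e (?p - 1 - i) \<in> U (Suc m)" if "i \<le> m" for i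
      using U_mono that by (meson Suc_lessD subset_eq)
    let ?j = "?p - 1 - m"
    have j: "0 < ?j" "?j < ?p" using Suc.prems by auto
    have "?S *v e ?j \<in> U (Suc m)" using Suc by (intro SU) auto
    moreover have "(if Suc ?j < ?p then e (Suc ?j) + e ?j else 0) \<in> U (Suc m)"
    proof (cases "m = 0")
      case True
      then have "\<not> Suc ?j < ?p" by auto
      then show ?thesis by (simp add: U_def span_zero)
    next
      case False
      then have "Suc ?j = ?p - 1 - (m - 1)" using Suc.prems by auto
      then show ?thesis
        using IH[of "m - 1"] IH[of m] by (auto simp: U_def intro: span_add span_zero)
    qed
    ultimately have "e (?j - 1) \<in> U (Suc m)"
      unfolding down[OF j] using IH[of m] by (auto simp only: U_def intro!: span_diff span_scale)
    then show ?case
      using IH by (auto simp: le_Suc_eq)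
  qed (use U0 in simp)
  have "z \<in> U (?p - 1)" for z
  proof -
    have "e j \<in> U (?p - 1)" if "j < ?p" for j
    proof -
      have "?p - 1 - (?p - 1 - j) = j" using that by simp
      then show ?thesis using eU[of "?p - 1"] p0 by (metis diff_le_self diff_less zero_less_one)
    qed
    then have "(\<Sum>j<?p. (e j \<bullet> z) *\<^sub>R e j) \<in> U (?p - 1)"
      unfolding U_def by (intro span_sum span_scale) auto
    then show ?thesis
      using orthonormal_expand[of "{..<?p}" e z] on by simp
  qed
  moreover have "{..?p - 1} = {..<?p}" by (metis Suc_pred' lessThan_Suc_atMost p0)
  ultimately have "cyclic_vector ?S (e (?p - 1))"
    by (auto simp: cyclic_vector_def U_def)
  then show ?thesis by (rule that)
qed

section \<open>Zero sets of polynomials\<close>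

text \<open>
Real polynomial functions of the variables in \<open>J\<close>, as plain functions of an assignment. The inductive
form delivers by one induction each that such a function is measurable, is a univariate polynomial in
each coordinate separately, and stays polynomial when a coordinate is frozen.
\<close>
inductive polynomial_in :: "'i set \<Rightarrow> (('i \<Rightarrow> real) \<Rightarrow> real) \<Rightarrow> bool" for J where
  const: "polynomial_in J (\<lambda>_. c)"
| coord: "i \<in> J \<Longrightarrow> polynomial_in J (\<lambda>z. z i)"
| add: "polynomial_in J f \<Longrightarrow> polynomial_in J g \<Longrightarrow> polynomial_in J (\<lambda>z. f z + g z)"
| mult: "polynomial_in J f \<Longrightarrow> polynomial_in J g \<Longrightarrow> polynomial_in J (\<lambda>z. f z * g z)"

lemma polynomial_in_diff:
  assumes "polynomial_in J f" "polynomial_in J g"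
  shows "polynomial_in J (\<lambda>z. f z - g z)"
  using polynomial_in.add[OF assms(1) polynomial_in.mult[OF polynomial_in.const[of J "-1"] assms(2)]]
  by simp

lemma polynomial_in_divide: "polynomial_in J f \<Longrightarrow> polynomial_in J (\<lambda>z. f z / c)"
  using polynomial_in.mult[OF polynomial_in.const[of J "1 / c"], of f] by simp

lemma polynomial_in_power: "polynomial_in J f \<Longrightarrow> polynomial_in J (\<lambda>z. f z ^ k)"
  by (induction k) (auto intro: polynomial_in.intros)

lemma polynomial_in_sum:
  "(\<And>a. a \<in> A \<Longrightarrow> polynomial_in J (f a)) \<Longrightarrow> polynomial_in J (\<lambda>z. \<Sum>a\<in>A. f a z)"
  by (induction A rule: infinite_finite_induct) (auto intro: polynomial_in.intros)

lemma polynomial_in_prod: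
  "(\<And>a. a \<in> A \<Longrightarrow> polynomial_in J (f a)) \<Longrightarrow> polynomial_in J (\<lambda>z. \<Prod>a\<in>A. f a z)"
  by (induction A rule: infinite_finite_induct) (auto intro: polynomial_in.intros)

lemmas polynomial_in_intros =
  polynomial_in.intros polynomial_in_diff polynomial_in_divide polynomial_in_power polynomial_in_sum polynomial_in_prod

lemma polynomial_in_along_coordinate:
  assumes "polynomial_in J f"
  shows "real_polynomial_function (\<lambda>t. f (z(j := t)))"
  using assms
proof induction
  case (coord i)
  have "real_polynomial_function (\<lambda>t::real. t)"
    by (intro real_polynomial_function.intros bounded_linear_ident)
  then show ?case by (cases "i = j") (auto intro: real_polynomial_function.intros)
qed (auto intro: real_polynomial_function.intros)

lemma polynomial_in_fix_coordinate:
  assumes "polynomial_in (insert j J) f"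
  shows "polynomial_in J (\<lambda>z. f (z(j := t)))"
  using assms
proof induction
  case (coord i)
  then show ?case
    by (cases "i = j") (auto intro: polynomial_in.intros)
qed (auto intro: polynomial_in.intros)

lemma polynomial_in_measurable:
  assumes "polynomial_in J f" "\<And>j. j \<in> J \<Longrightarrow> sets (\<mu> j) = sets borel"
  shows "f \<in> borel_measurable (PiM J \<mu>)"
  using assms(1)
proof induction
  case (coord i)
  then show ?case
    using measurable_component_singleton[of i J \<mu>] measurable_cong_sets[OF refl assms(2)[of i]] by blast
qed auto

lemma real_polynomial_function_finite_zeros:
  fixes f :: "real \<Rightarrow> real"
  assumes "real_polynomial_function f" "f w \<noteq> 0"
  shows "finite {t. f t = 0}"
proof -
  obtain a n where a: "f = (\<lambda>x. \<Sum>i\<le>n. a i * x ^ i)"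
    using assms(1) real_polynomial_function_iff_sum by blast
  then have "\<exists>i\<le>n. a i \<noteq> 0"
    using assms(2) by (metis (no_types, lifting) atMost_iff mult_zero_left sum.neutral)
  then show ?thesis
    using polyfun_finite_roots[of a n] a by simp
qed

text \<open>
The zero set of a nonzero polynomial is null for every product of diffuse measures. Adding one
variable at a time: freeze the new variable at its value in the point \<open>w\<close>; by induction almost every
choice \<open>z\<close> of the old variables keeps the polynomial nonzero, so as a function of the new variable it
has finitely many zeros, and Fubini applies.
\<close>
lemma AE_polynomial_nonzero:
  fixes \<mu> :: "real measure"
  assumes "finite J" and \<mu>: "prob_space \<mu>" "sets \<mu> = sets borel"
    and diffuse: "\<And>t. emeasure \<mu> {t} = 0"
    and f: "polynomial_in J f" "w \<in> extensional J" "f w \<noteq> 0"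
  shows "AE z in PiM J (\<lambda>_. \<mu>). f z \<noteq> 0"
  using \<open>finite J\<close> f
proof (induction J arbitrary: f w rule: finite_induct)
  case empty
  then have "w = (\<lambda>_. undefined)" by auto
  with empty show ?case by (intro AE_I2) (auto simp: space_PiM)
next
  case (insert j J)
  interpret \<mu>: prob_space \<mu> by fact
  interpret P: product_sigma_finite "\<lambda>_. \<mu>" by unfold_locales
  have meas: "f \<in> borel_measurable (PiM (insert j J) (\<lambda>_. \<mu>))"
    by (rule polynomial_in_measurable[OF insert.prems(1) \<mu>(2)])
  define Z where "Z = {z \<in> space (PiM (insert j J) (\<lambda>_. \<mu>)). f z = 0}"
  have Z: "Z \<in> sets (PiM (insert j J) (\<lambda>_. \<mu>))"
    unfolding Z_def using meas by measurable
  have "AE z in PiM J (\<lambda>_. \<mu>). f (z(j := w j)) \<noteq> 0"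
  proof (rule insert.IH)
    show "polynomial_in J (\<lambda>z. f (z(j := w j)))"
      by (rule polynomial_in_fix_coordinate[OF insert.prems(1)])
    show "w(j := undefined) \<in> extensional J"
      using insert.prems(2) by (auto simp: extensional_def)
    have "(w(j := undefined))(j := w j) = w" by auto
    then show "f ((w(j := undefined))(j := w j)) \<noteq> 0"
      using insert.prems(3) by simp
  qed
  then have "AE z in PiM J (\<lambda>_. \<mu>). (\<integral>\<^sup>+t. indicator Z (z(j := t)) \<partial>\<mu>) = 0"
  proof (rule AE_mp, intro AE_I2 impI)
    fix z assume z: "z \<in> space (PiM J (\<lambda>_. \<mu>))" "f (z(j := w j)) \<noteq> 0"
    have fin: "finite {t. f (z(j := t)) = 0}"
      by (rule real_polynomial_function_finite_zeros[OF polynomial_in_along_coordinate[OF insert.prems(1)] z(2)])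
    have sub: "{t. z(j := t) \<in> Z} \<subseteq> {t. f (z(j := t)) = 0}"
      by (auto simp: Z_def)
    have fin': "finite {t. z(j := t) \<in> Z}" using finite_subset[OF sub fin] .
    have "(\<integral>\<^sup>+t. indicator Z (z(j := t)) \<partial>\<mu>) = (\<integral>\<^sup>+t. indicator {t. z(j := t) \<in> Z} t \<partial>\<mu>)"
      by (intro nn_integral_cong) (auto simp: indicator_def)
    also have "\<dots> = emeasure \<mu> {t. z(j := t) \<in> Z}"
      using borel_closed[OF finite_imp_closed[OF fin']] \<mu>(2) by (intro nn_integral_indicator) simp
    also have "\<dots> = (\<Sum>t\<in>{t. z(j := t) \<in> Z}. emeasure \<mu> {t})"
      using fin' \<mu>(2) by (intro emeasure_eq_sum_singleton) auto
    also have "\<dots> = 0" by (simp add: diffuse)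
    finally show "(\<integral>\<^sup>+t. indicator Z (z(j := t)) \<partial>\<mu>) = 0" .
  qed
  then have "(\<integral>\<^sup>+z. (\<integral>\<^sup>+t. indicator Z (z(j := t)) \<partial>\<mu>) \<partial>PiM J (\<lambda>_. \<mu>)) = (\<integral>\<^sup>+z. 0 \<partial>PiM J (\<lambda>_. \<mu>))"
    by (intro nn_integral_cong_AE)
  moreover have "emeasure (PiM (insert j J) (\<lambda>_. \<mu>)) Z =
      (\<integral>\<^sup>+z. (\<integral>\<^sup>+t. indicator Z (z(j := t)) \<partial>\<mu>) \<partial>PiM J (\<lambda>_. \<mu>))"
    using P.product_nn_integral_insert[OF insert.hyps, of "indicator Z"] Z by simp
  ultimately have "emeasure (PiM (insert j J) (\<lambda>_. \<mu>)) Z = 0" by simp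
  then show ?case
    using Z by (intro AE_I[of _ _ Z]) (auto simp: Z_def)
qed

lemma polynomial_in_krylov_det:
  fixes X :: "('i \<Rightarrow> real) \<Rightarrow> nat \<Rightarrow> real ^ 'p"
  assumes X: "\<And>i a. i \<in> {1..n} \<Longrightarrow> polynomial_in J (\<lambda>z. X z i $ a)"
  shows "polynomial_in J (\<lambda>z. det (\<chi> i. (((*v) (sample_cov n (X z))) ^^ \<iota> i) \<theta>))"
proof -
  have mean: "polynomial_in J (\<lambda>z. sample_mean n (X z) $ a)" for a
    using X by (auto simp: sample_mean_def intro!: polynomial_in_intros)
  have step: "polynomial_in J (\<lambda>z. (sample_cov n (X z) *v Y z) $ a)"
    if "\<And>b. polynomial_in J (\<lambda>z. Y z $ b)" for Y :: "('i \<Rightarrow> real) \<Rightarrow> real ^ 'p" and a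
    unfolding sample_cov_mult_vec using X mean that
    by (auto simp: inner_vec_def intro!: polynomial_in_intros)
  have "polynomial_in J (\<lambda>z. (((*v) (sample_cov n (X z))) ^^ k) \<theta> $ a)" for k a
    by (induction k arbitrary: a) (auto intro: step polynomial_in_intros)
  then show ?thesis
    by (auto simp: det_def intro!: polynomial_in_intros)
qed

section \<open>Rotation invariance of Lebesgue measure\<close>

text \<open>
Translation invariance determines Lebesgue measure up to a factor, and the unit ball, which \<open>R\<close> maps
onto itself, shows that the factor is \<open>1\<close>. The computation is the classical one: evaluate
\<open>\<integral>\<integral> 1\<^sub>A (R x + y) 1\<^sub>B y\<close> in both orders, with a translation in the inner integral each time.
\<close>
lemma lborel_distr_orthogonal_transformation:
  fixes R :: "'a :: euclidean_space \<Rightarrow> 'a"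
  assumes R: "orthogonal_transformation R"
  shows "distr lborel borel R = lborel"
proof -
  have lin: "linear R" and nrm: "\<And>x. norm (R x) = norm x"
    using R by (auto simp: orthogonal_transformation_linear orthogonal_transformation_norm)
  have [measurable]: "R \<in> borel_measurable borel"
    by (intro borel_measurable_continuous_onI linear_continuous_on linear_conv_bounded_linear[THEN iffD1] lin)
  have shift: "(\<integral>\<^sup>+x. f (x + a) \<partial>lborel) = (\<integral>\<^sup>+x. f x \<partial>lborel)"
    if [measurable]: "f \<in> borel_measurable borel" for f :: "'a \<Rightarrow> ennreal" and a
  proof -
    have "(\<integral>\<^sup>+x. f x \<partial>lborel) = (\<integral>\<^sup>+x. f x \<partial>distr lborel borel ((+) a))"
      by (simp add: lborel_distr_plus)
    also have "\<dots> = (\<integral>\<^sup>+x. f (a + x) \<partial>lborel)"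
      by (subst nn_integral_distr) simp_all
    finally show ?thesis by (simp add: add.commute)
  qed
  define B where "B = cball (0 :: 'a) 1"
  have [measurable]: "B \<in> sets borel" by (simp add: B_def)
  have B: "emeasure lborel B \<noteq> 0" "emeasure lborel B \<noteq> \<infinity>"
  proof -
    have "emeasure lborel (ball (0 :: 'a) 1) \<noteq> 0"
      using content_ball_pos[of 1 "0 :: 'a"] by (auto simp: measure_def)
    moreover have "emeasure lborel (ball (0 :: 'a) 1) \<le> emeasure lborel B"
      by (intro emeasure_mono) (auto simp: B_def)
    ultimately show "emeasure lborel B \<noteq> 0" by auto
    show "emeasure lborel B \<noteq> \<infinity>" using emeasure_lborel_cball_finite[of "0 :: 'a" 1] by (auto simp: B_def)
  qed
  have "emeasure (distr lborel borel R) A = emeasure lborel A" if [measurable]: "A \<in> sets borel" for A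
  proof -
    let ?IA = "indicator A :: 'a \<Rightarrow> ennreal" and ?IB = "indicator B :: 'a \<Rightarrow> ennreal"
    have inv: "\<exists>z. R z = y" for y using orthogonal_transformation_surj[OF R] by (metis surj_def)
    have "emeasure (distr lborel borel R) A * emeasure lborel B =
        (\<integral>\<^sup>+x. ?IA x \<partial>distr lborel borel R) * (\<integral>\<^sup>+y. ?IB y \<partial>lborel)"
      by simp
    also have "\<dots> = (\<integral>\<^sup>+x. ?IA (R x) \<partial>lborel) * (\<integral>\<^sup>+y. ?IB y \<partial>lborel)"
      by (subst nn_integral_distr) simp_all
    also have "\<dots> = (\<integral>\<^sup>+y. (\<integral>\<^sup>+x. ?IA (R x) \<partial>lborel) * ?IB y \<partial>lborel)"
      by (simp add: nn_integral_cmult)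
    also have "\<dots> = (\<integral>\<^sup>+y. (\<integral>\<^sup>+x. ?IA (R x + y) * ?IB y \<partial>lborel) \<partial>lborel)"
    proof (rule nn_integral_cong)
      fix y :: 'a
      obtain z where z: "R z = y" using inv by blast
      have "(\<integral>\<^sup>+x. ?IA (R x) \<partial>lborel) = (\<integral>\<^sup>+x. ?IA (R (x + z)) \<partial>lborel)"
        by (rule shift[symmetric]) measurable
      also have "\<dots> = (\<integral>\<^sup>+x. ?IA (R x + y) \<partial>lborel)"
        by (simp add: linear_add[OF lin] z)
      finally show "(\<integral>\<^sup>+x. ?IA (R x) \<partial>lborel) * ?IB y = (\<integral>\<^sup>+x. ?IA (R x + y) * ?IB y \<partial>lborel)"
        by (simp add: nn_integral_multc)
    qed
    also have "\<dots> = (\<integral>\<^sup>+x. (\<integral>\<^sup>+y. ?IA (R x + y) * ?IB y \<partial>lborel) \<partial>lborel)"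
      by (rule lborel_pair.Fubini') measurable
    also have "\<dots> = (\<integral>\<^sup>+x. (\<integral>\<^sup>+y. ?IA y * ?IB (y - R x) \<partial>lborel) \<partial>lborel)"
    proof (rule nn_integral_cong)
      fix x
      have "(\<integral>\<^sup>+y. ?IA y * ?IB (y - R x) \<partial>lborel) = (\<integral>\<^sup>+y. ?IA (y + R x) * ?IB (y + R x - R x) \<partial>lborel)"
        by (rule shift[symmetric]) measurable
      then show "(\<integral>\<^sup>+y. ?IA (R x + y) * ?IB y \<partial>lborel) = (\<integral>\<^sup>+y. ?IA y * ?IB (y - R x) \<partial>lborel)"
        by (simp add: add.commute)
    qed
    also have "\<dots> = (\<integral>\<^sup>+y. (\<integral>\<^sup>+x. ?IA y * ?IB (y - R x) \<partial>lborel) \<partial>lborel)"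
      by (rule lborel_pair.Fubini') measurable
    also have "\<dots> = (\<integral>\<^sup>+y. ?IA y * (\<integral>\<^sup>+x. ?IB x \<partial>lborel) \<partial>lborel)"
    proof (rule nn_integral_cong)
      fix y :: 'a
      obtain z where z: "R z = y" using inv by blast
      have "(\<integral>\<^sup>+x. ?IB (y - R x) \<partial>lborel) = (\<integral>\<^sup>+x. ?IB (y - R (x + z)) \<partial>lborel)"
        by (rule shift[symmetric]) measurable
      also have "\<dots> = (\<integral>\<^sup>+x. ?IB x \<partial>lborel)"
        by (intro nn_integral_cong) (simp add: linear_add[OF lin] z B_def indicator_def nrm)
      finally show "(\<integral>\<^sup>+x. ?IA y * ?IB (y - R x) \<partial>lborel) = ?IA y * (\<integral>\<^sup>+x. ?IB x \<partial>lborel)"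
        by (simp add: nn_integral_cmult)
    qed
    also have "\<dots> = emeasure lborel A * emeasure lborel B"
      by (simp add: nn_integral_multc)
    finally show ?thesis
      using B by (simp add: mult.commute[of _ "emeasure lborel B"] ennreal_mult_cancel_left)
  qed
  then show ?thesis by (intro measure_eqI) auto
qed

section \<open>Coordinates of a spiked normal vector\<close>

text \<open>
An orthonormal basis numbered \<open>0, \<dots>, CARD('p) - 1\<close>. The spike direction comes last, so that the
remaining directions are indexed by \<open>{..<CARD('p) - 1}\<close>, which is the index set in the definition of the
chi-square distribution with \<open>CARD('p) - 1\<close> degrees of freedom.
\<close>
definition frame :: "real ^ 'p \<Rightarrow> (nat \<Rightarrow> real ^ 'p) \<Rightarrow> bool" where
  "frame \<theta> e \<longleftrightarrow> e (CARD('p) - 1) = \<theta> \<and>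
     (\<forall>i<CARD('p). \<forall>j<CARD('p). e i \<bullet> e j = (if i = j then 1 else 0))"

lemma frame_exists:
  fixes \<theta> :: "real ^ 'p"
  assumes "norm \<theta> = 1"
  obtains e where "frame \<theta> e"
proof -
  let ?p = "CARD('p)"
  obtain B where B: "\<theta> \<in> B" "pairwise orthogonal B" "\<And>x. x \<in> B \<Longrightarrow> norm x = 1"
    "independent B" "card B = DIM(real ^ 'p)"
    using vector_in_orthonormal_basis[OF assms] by metis
  have fin: "finite B" using B(4) by (simp add: independent_bound)
  have "card (B - {\<theta>}) = ?p - 1" using B fin by simp
  then obtain h where h: "bij_betw h {..<?p - 1} (B - {\<theta>})"
    using fin by (metis ex_bij_betw_nat_finite finite_Diff atLeast0LessThan)
  define e where "e k = (if k < ?p - 1 then h k else \<theta>)" for k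
  have mem: "e k \<in> B" for k
    using h B(1) by (auto simp: e_def bij_betw_def)
  have "e i \<noteq> e j" if "i < ?p" "j < ?p" "i \<noteq> j" for i j
  proof -
    have "h k \<noteq> \<theta>" if "k < ?p - 1" for k
      using h that by (auto simp: bij_betw_def)
    moreover have "inj_on h {..<?p - 1}" using h by (simp add: bij_betw_def)
    ultimately show ?thesis
      using that unfolding e_def by (smt (verit) Suc_pred' inj_onD lessThan_iff less_Suc_eq zero_less_card_finite)
  qed
  then have "e i \<bullet> e j = (if i = j then 1 else 0)" if "i < ?p" "j < ?p" for i j
    using that mem[of i] mem[of j] B(2,3) by (auto simp: pairwise_def orthogonal_def norm_eq_1)
  then have "frame \<theta> e" by (auto simp: frame_def e_def)
  then show ?thesis by (rule that)
qed

text \<open>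
The standard deviation of the \<open>k\<close>-th frame coordinate under the covariance \<open>I + \<rho> \<theta> \<theta>'\<close>.
\<close>
definition spike_scale :: "nat \<Rightarrow> real \<Rightarrow> nat \<Rightarrow> real" where
  "spike_scale p \<rho> k = (if k = p - 1 then sqrt (1 + \<rho>) else 1)"

text \<open>
The solution \<open>y\<close> of \<open>y + \<rho> (\<theta> \<bullet> y) \<theta> = x\<close> with \<open>\<rho> = s * v\<close> is found by pairing with \<open>\<theta>\<close> first.
\<close>
lemma spiked_cov_inverse_form:
  fixes e :: "nat \<Rightarrow> real ^ 'p"
  assumes e: "frame \<theta> e" and \<rho>: "s * v \<ge> 0"
  shows "x \<bullet> (matrix_inv (spiked_cov \<theta> s v) *v x) =
    (\<Sum>k<CARD('p). (e k \<bullet> x)\<^sup>2 / (spike_scale CARD('p) (s * v) k)\<^sup>2)"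
proof -
  let ?C = "spiked_cov \<theta> s v" and ?p = "CARD('p)"
  have \<theta>\<theta>: "\<theta> \<bullet> \<theta> = 1" using e unfolding frame_def by (metis diff_less zero_less_card_finite zero_less_one)
  have C: "?C *v y = y + (s * v * (\<theta> \<bullet> y)) *\<^sub>R \<theta>" for y
    by (simp add: spiked_cov_def matrix_vector_mult_add_rdistrib outer_mult_vec flip: scaleR_matrix_vector_assoc)
  have C\<theta>: "\<theta> \<bullet> (?C *v y) = (1 + s * v) * (\<theta> \<bullet> y)" for y
    by (simp add: C inner_add_right \<theta>\<theta> algebra_simps)
  have "y = 0" if "?C *v y = 0" for y
  proof -
    have "\<theta> \<bullet> y = 0" using C\<theta>[of y] that \<rho> by auto
    then show ?thesis using C[of y] that by simp
  qed
  then have "invertible ?C"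
    by (simp add: invertible_left_inverse matrix_left_invertible_ker)
  then have "?C ** matrix_inv ?C = mat 1"
    unfolding invertible_def matrix_inv_def by (rule someI2_ex) simp
  then have inv: "?C *v (matrix_inv ?C *v x) = x"
    by (simp add: matrix_vector_mul_assoc)
  define y where "y = matrix_inv ?C *v x"
  have y: "y = x - (s * v * (\<theta> \<bullet> y)) *\<^sub>R \<theta>" using inv C[of y] by (simp add: y_def algebra_simps)
  have \<theta>y: "\<theta> \<bullet> y = (\<theta> \<bullet> x) / (1 + s * v)"
    using C\<theta>[of y] inv \<rho> by (simp add: y_def field_simps)
  have "x \<bullet> y = x \<bullet> (x - (s * v * (\<theta> \<bullet> y)) *\<^sub>R \<theta>)" using y by metis
  also have "\<dots> = x \<bullet> x - s * v / (1 + s * v) * (\<theta> \<bullet> x)\<^sup>2"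
    by (simp add: inner_diff_right \<theta>y power2_eq_square inner_commute)
  also have "x \<bullet> x = (\<Sum>k<?p. (e k \<bullet> x)\<^sup>2)"
    using orthonormal_parseval[of "{..<?p}" e x x] e by (simp add: frame_def power2_eq_square)
  also have "{..<?p} = insert (?p - 1) {..<?p - 1}" by auto
  also have "(\<Sum>k\<in>\<dots>. (e k \<bullet> x)\<^sup>2) - s * v / (1 + s * v) * (\<theta> \<bullet> x)\<^sup>2 =
      (\<theta> \<bullet> x)\<^sup>2 / (1 + s * v) + (\<Sum>k<?p - 1. (e k \<bullet> x)\<^sup>2)"
    using e \<rho> by (simp add: frame_def field_simps)
  also have "\<dots> = (\<Sum>k\<in>insert (?p - 1) {..<?p - 1}. (e k \<bullet> x)\<^sup>2 / (spike_scale ?p (s * v) k)\<^sup>2)"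
    using e \<rho> by (simp add: frame_def spike_scale_def)
  also have "insert (?p - 1) {..<?p - 1} = {..<?p}" by auto
  finally show ?thesis by (simp add: y_def)
qed

lemma spike_scale_pos: "\<rho> \<ge> 0 \<Longrightarrow> spike_scale p \<rho> k > 0"
  by (simp add: spike_scale_def)

lemma nn_integral_normal_density_rescaled:
  assumes "c > 0" "A \<in> sets borel"
  shows "(\<integral>\<^sup>+t. ennreal (normal_density 0 c t) * indicator A (t / c) \<partial>lborel) =
    emeasure std_normal_distribution A"
proof -
  have "(\<integral>\<^sup>+t. ennreal (normal_density 0 c t) * indicator A (t / c) \<partial>lborel) =
      ennreal \<bar>c\<bar> * (\<integral>\<^sup>+t. ennreal (normal_density 0 c (0 + c * t)) * indicator A ((0 + c * t) / c) \<partial>lborel)"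
    using assms by (intro nn_integral_real_affine) auto
  also have "\<dots> = (\<integral>\<^sup>+t. ennreal c * (ennreal (normal_density 0 c (c * t)) * indicator A t) \<partial>lborel)"
    using assms by (simp add: nn_integral_cmult)
  also have "\<dots> = (\<integral>\<^sup>+t. ennreal (std_normal_density t) * indicator A t \<partial>lborel)"
    using assms by (intro nn_integral_cong)
      (simp add: normal_density_def real_sqrt_mult power_mult_distrib ennreal_mult'[symmetric] mult.assoc[symmetric])
  also have "\<dots> = emeasure std_normal_distribution A"
    using assms by (simp add: emeasure_density)
  finally show ?thesis .
qed

text \<open>
After the rotation \<open>R\<close> that takes the standard basis to the frame, the density is a product of normal
densities up to a constant \<open>K\<close>, which absorbs the determinant of the covariance. As both densities have
total mass \<open>1\<close>, necessarily \<open>K = 1\<close>.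
\<close>
lemma spiked_normal_coordinates:
  fixes e :: "nat \<Rightarrow> real ^ 'p" and X :: "'a \<Rightarrow> real ^ 'p"
  assumes M: "prob_space M" and e: "frame \<theta> e" and \<rho>: "s * v \<ge> 0"
    and X: "distributed M lborel X (\<lambda>x. ennreal (mvn_density 0 (spiked_cov \<theta> s v) x))"
    and A: "\<And>k. A k \<in> sets borel"
  shows "emeasure M {\<omega> \<in> space M. \<forall>k<CARD('p). e k \<bullet> X \<omega> / spike_scale CARD('p) (s * v) k \<in> A k} =
    (\<Prod>k<CARD('p). emeasure std_normal_distribution (A k))"
proof -
  interpret prob_space M by fact
  let ?p = "CARD('p)" and ?c = "spike_scale CARD('p) (s * v)" and ?C = "spiked_cov \<theta> s v"
  have on: "e i \<bullet> e j = (if i = j then 1 else 0)" if "i < ?p" "j < ?p" for i j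
    using e that by (simp add: frame_def)
  have c: "?c k > 0" for k using spike_scale_pos[OF \<rho>] .
  have "card (Basis :: (real ^ 'p) set) = ?p" by simp
  then obtain \<iota> where \<iota>: "bij_betw \<iota> (Basis :: (real ^ 'p) set) {..<?p}"
    by (metis atLeast0LessThan bij_betw_inv finite_Basis ex_bij_betw_nat_finite)
  have \<iota>_lt: "\<iota> b < ?p" if "b \<in> Basis" for b using \<iota> that by (auto simp: bij_betw_def)
  have \<iota>_eq: "\<iota> b = \<iota> b' \<longleftrightarrow> b = b'" if "b \<in> Basis" "b' \<in> Basis" for b b'
    using \<iota> that by (auto simp: bij_betw_def inj_on_def)
  define R where "R y = (\<Sum>b\<in>Basis. (y \<bullet> b) *\<^sub>R e (\<iota> b))" for y :: "real ^ 'p"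
  have eR: "e (\<iota> b) \<bullet> R y = y \<bullet> b" if "b \<in> Basis" for b y
  proof -
    have "e (\<iota> b) \<bullet> R y = (\<Sum>b'\<in>Basis. (y \<bullet> b') * (if b = b' then 1 else 0))"
      unfolding R_def inner_sum_right using on that by (intro sum.cong) (auto simp: \<iota>_lt \<iota>_eq)
    then show ?thesis using that by (simp add: if_distrib cong: if_cong)
  qed
  have R: "orthogonal_transformation R"
    unfolding orthogonal_transformation_def
  proof (intro conjI allI)
    show "linear R"
      by (rule linearI) (simp_all add: R_def inner_add_left scaleR_add_left sum.distrib scaleR_sum_right)
    fix y z
    have "R y \<bullet> R z = (\<Sum>b\<in>Basis. (y \<bullet> b) * (e (\<iota> b) \<bullet> R z))"
      by (subst (1) R_def) (simp add: inner_sum_left)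
    also have "\<dots> = y \<bullet> z" by (simp add: eR euclidean_inner[of y z])
    finally show "R y \<bullet> R z = y \<bullet> z" .
  qed
  define K where "K = (\<Prod>b\<in>(Basis :: (real ^ 'p) set). sqrt (2 * pi * (?c (\<iota> b))\<^sup>2)) / sqrt ((2 * pi) ^ ?p * det ?C)"
  have dens: "mvn_density 0 ?C (R y) = K * (\<Prod>b\<in>Basis. normal_density 0 (?c (\<iota> b)) (y \<bullet> b))" for y
  proof -
    have "R y \<bullet> (matrix_inv ?C *v R y) = (\<Sum>k<?p. (e k \<bullet> R y)\<^sup>2 / (?c k)\<^sup>2)"
      by (rule spiked_cov_inverse_form[OF e \<rho>])
    also have "\<dots> = (\<Sum>b\<in>Basis. (y \<bullet> b)\<^sup>2 / (?c (\<iota> b))\<^sup>2)"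
      using sum.reindex_bij_betw[OF \<iota>, of "\<lambda>k. (e k \<bullet> R y)\<^sup>2 / (?c k)\<^sup>2"] by (simp add: eR)
    finally have "exp (- (R y \<bullet> (matrix_inv ?C *v R y)) / 2) =
        (\<Prod>b\<in>Basis. exp (- (y \<bullet> b)\<^sup>2 / (2 * (?c (\<iota> b))\<^sup>2)))"
      by (simp add: exp_sum[symmetric] sum_divide_distrib sum_negf[symmetric] mult.commute)
    moreover have "(\<Prod>b\<in>(Basis :: (real ^ 'p) set). sqrt (2 * pi * (?c (\<iota> b))\<^sup>2)) \<noteq> 0"
      using c by (auto simp: less_imp_neq[THEN not_sym])
    ultimately show ?thesis
      by (simp add: mvn_density_def K_def normal_density_def prod.distrib prod_dividef)
  qed
  have box: "emeasure M {\<omega> \<in> space M. \<forall>k<?p. e k \<bullet> X \<omega> / ?c k \<in> A k} =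
      ennreal K * (\<Prod>k<?p. emeasure std_normal_distribution (A k))"
    if A: "\<And>k. A k \<in> sets borel" for A
  proof -
    note A[measurable]
    define D where "D = {x. \<forall>k<?p. e k \<bullet> x / ?c k \<in> A k}"
    have [measurable]: "D \<in> sets borel" unfolding D_def by measurable
    have [measurable]: "R \<in> borel_measurable borel" unfolding R_def by measurable
    have [measurable]: "(\<lambda>x. ennreal (mvn_density 0 ?C x)) \<in> borel_measurable borel"
      using X by (auto simp: distributed_def)
    have ind: "indicator D (R y) = (\<Prod>b\<in>Basis. indicator (A (\<iota> b)) ((y \<bullet> b) / ?c (\<iota> b)) :: ennreal)" for y
    proof -
      have "R y \<in> D \<longleftrightarrow> (\<forall>k\<in>\<iota> ` Basis. e k \<bullet> R y / ?c k \<in> A k)"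
        using \<iota> by (auto simp: D_def bij_betw_def)
      also have "\<dots> \<longleftrightarrow> (\<forall>b\<in>Basis. (y \<bullet> b) / ?c (\<iota> b) \<in> A (\<iota> b))"
        by (simp add: eR)
      finally have "R y \<in> D \<longleftrightarrow> (\<forall>b\<in>Basis. (y \<bullet> b) / ?c (\<iota> b) \<in> A (\<iota> b))" .
      then show ?thesis by (auto simp: indicator_def prod_zero_iff)
    qed
    have "{\<omega> \<in> space M. \<forall>k<?p. e k \<bullet> X \<omega> / ?c k \<in> A k} = X -` D \<inter> space M"
      by (auto simp: D_def)
    then have "emeasure M {\<omega> \<in> space M. \<forall>k<?p. e k \<bullet> X \<omega> / ?c k \<in> A k} =
        (\<integral>\<^sup>+x. ennreal (mvn_density 0 ?C x) * indicator D x \<partial>lborel)"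
      using distributed_emeasure[OF X, of D] by simp
    also have "\<dots> = (\<integral>\<^sup>+x. ennreal (mvn_density 0 ?C x) * indicator D x \<partial>distr lborel borel R)"
      by (simp add: lborel_distr_orthogonal_transformation[OF R])
    also have "\<dots> = (\<integral>\<^sup>+y. ennreal (mvn_density 0 ?C (R y)) * indicator D (R y) \<partial>lborel)"
      by (subst nn_integral_distr) simp_all
    also have "\<dots> = (\<integral>\<^sup>+y. ennreal K * (\<Prod>b\<in>Basis. ennreal (normal_density 0 (?c (\<iota> b)) (y \<bullet> b)) *
        indicator (A (\<iota> b)) ((y \<bullet> b) / ?c (\<iota> b))) \<partial>lborel)"
      by (intro nn_integral_cong)
        (simp add: dens ind prod.distrib prod_ennreal prod_nonneg ennreal_mult'' mult.assoc)
    also have "\<dots> = ennreal K * (\<Prod>b\<in>(Basis :: (real ^ 'p) set). (\<integral>\<^sup>+t. ennreal (normal_density 0 (?c (\<iota> b)) t) *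
        indicator (A (\<iota> b)) (t / ?c (\<iota> b)) \<partial>lborel))"
      by (subst nn_integral_cmult, measurable) (subst nn_integral_lborel_prod, auto)
    also have "\<dots> = ennreal K * (\<Prod>b\<in>(Basis :: (real ^ 'p) set). emeasure std_normal_distribution (A (\<iota> b)))"
      by (simp add: nn_integral_normal_density_rescaled[OF c A])
    also have "\<dots> = ennreal K * (\<Prod>k<?p. emeasure std_normal_distribution (A k))"
      using prod.reindex_bij_betw[OF \<iota>, of "\<lambda>k. emeasure std_normal_distribution (A k)"] by simp
    finally show ?thesis .
  qed
  interpret N: prob_space std_normal_distribution
    by (rule prob_space_normal_density) simp
  have "ennreal K = 1"
    using box[of "\<lambda>_. UNIV"] emeasure_space_1 N.emeasure_space_1 by simp
  then show ?thesis using box[OF A] by simp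
qed

section \<open>Independent standard normal variables\<close>

abbreviation gauss :: "'i set \<Rightarrow> ('i \<Rightarrow> real) measure" where
  "gauss J \<equiv> PiM J (\<lambda>_. std_normal_distribution)"

lemma prob_space_gauss: "prob_space (gauss J)"
  by (intro prob_space_PiM prob_space_normal_density) simp

lemma product_sigma_finite_gauss: "product_sigma_finite (\<lambda>_. std_normal_distribution)"
  by (intro product_sigma_finite.intro prob_space_imp_sigma_finite prob_space_normal_density) simp

lemma sets_gauss: "sets (gauss J) = sets (PiM J (\<lambda>_. borel))"
  by (intro sets_PiM_cong) auto

lemma measurable_gauss_iff [simp]: "measurable M (gauss J) = measurable M (PiM J (\<lambda>_. borel))"
  by (rule measurable_cong_sets[OF refl sets_gauss])

lemma measurable_from_gauss [simp]: "measurable (gauss J) N = measurable (PiM J (\<lambda>_. borel)) N"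
  by (rule measurable_cong_sets[OF sets_gauss refl])

lemma emeasure_std_normal_singleton: "emeasure std_normal_distribution {t} = 0"
  by (simp add: emeasure_density nn_integral_null_set null_sets_def)

lemma AE_gauss_polynomial_nonzero:
  assumes "finite J" "polynomial_in J f" "w \<in> extensional J" "f w \<noteq> 0"
  shows "AE z in gauss J. f z \<noteq> 0"
  by (rule AE_polynomial_nonzero[OF assms(1) _ _ emeasure_std_normal_singleton assms(2-4)])
    (auto intro: prob_space_normal_density)

lemma distr_gauss_component:
  assumes "j \<in> J"
  shows "distr (gauss J) borel (\<lambda>z. z j) = std_normal_distribution"
proof -
  have "distr (gauss J) borel (\<lambda>z. z j) = distr (gauss J) std_normal_distribution (\<lambda>z. z j)"
    by (intro distr_cong) auto
  also have "\<dots> = std_normal_distribution"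
    by (intro distr_PiM_component prob_space_normal_density assms) simp
  finally show ?thesis .
qed

lemma gauss_coordinate_normal:
  assumes "j \<in> J"
  shows "distributed (gauss J) lborel (\<lambda>z. z j) std_normal_density"
proof -
  have "distr (gauss J) lborel (\<lambda>z. z j) = distr (gauss J) borel (\<lambda>z. z j)"
    by (intro distr_cong) auto
  then show ?thesis
    using assms distr_gauss_component[OF assms] by (simp add: distributed_def)
qed

lemma gauss_coordinates_indep:
  assumes "J \<noteq> {}"
  shows "prob_space.indep_vars (gauss J) (\<lambda>_. borel) (\<lambda>j z. z j) J"
proof -
  interpret P: prob_space "gauss J" by (rule prob_space_gauss)
  have "distr (gauss J) (PiM J (\<lambda>_. borel)) (\<lambda>z. \<lambda>j\<in>J. z j) = distr (gauss J) (gauss J) (\<lambda>z. z)"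
    by (intro distr_cong) (auto simp: sets_gauss space_PiM PiE_restrict)
  also have "\<dots> = gauss J" by simp
  also have "\<dots> = PiM J (\<lambda>j. distr (gauss J) borel (\<lambda>z. z j))"
    by (intro PiM_cong) (simp_all add: distr_gauss_component)
  finally show ?thesis
    using assms by (subst P.indep_vars_iff_distr_eq_PiM') simp_all
qed

lemma gauss_blocks_indep:
  assumes "J \<noteq> {}" "\<And>l. l \<in> L \<Longrightarrow> K l \<subseteq> J" "disjoint_family_on K L"
    and Y: "\<And>l. l \<in> L \<Longrightarrow> Y l \<in> borel_measurable (PiM (K l) (\<lambda>_. borel))"
  shows "prob_space.indep_vars (gauss J) (\<lambda>_. borel) (\<lambda>l z. Y l (restrict z (K l))) L"
proof -
  interpret P: prob_space "gauss J" by (rule prob_space_gauss)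
  show ?thesis
    by (rule P.indep_vars_compose2[OF P.indep_vars_restrict[OF gauss_coordinates_indep[OF assms(1)] assms(2,3)]])
      (use Y in auto)
qed

section \<open>Chi-square laws\<close>

text \<open>
The same unit vector \<open>b\<close> applied to each of the \<open>q\<close> independent Gaussian columns gives \<open>q\<close> independent
standard normal variables.
\<close>
lemma gauss_linear_forms:
  fixes I :: "'i set" and b :: "'i \<Rightarrow> real"
  assumes I: "finite I" and b: "(\<Sum>i\<in>I. (b i)\<^sup>2) = 1" and q: "q > 0"
  shows "distr (gauss (I \<times> {..<q})) (gauss {..<q}) (\<lambda>z. \<lambda>k\<in>{..<q}. \<Sum>i\<in>I. b i * z (i, k)) = gauss {..<q}"
proof -
  let ?J = "I \<times> {..<q}" and ?g = "\<lambda>k z. \<Sum>i\<in>I. b i * z (i, k)"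
  interpret P: prob_space "gauss ?J" by (rule prob_space_gauss)
  have I0: "I \<noteq> {}" using b by auto
  then have J0: "?J \<noteq> {}" using q by auto
  have "P.indep_vars (\<lambda>_. borel) (\<lambda>k z. ?g k (restrict z (I \<times> {k}))) {..<q}"
    using J0 by (intro gauss_blocks_indep) (auto simp: disjoint_family_on_def)
  then have indep: "P.indep_vars (\<lambda>_. borel) ?g {..<q}"
    by (rule P.indep_vars_cong[THEN iffD1, rotated -1]) (auto intro!: ext sum.cong)
  have law: "distr (gauss ?J) borel (?g k) = std_normal_distribution" if k: "k < q" for k
  proof -
    \<comment> \<open>Vanishing coefficients contribute degenerate normal variables and are dropped first.\<close>
    define I' where "I' = {i \<in> I. b i \<noteq> 0}"
    have I': "finite I'" "I' \<noteq> {}" using I b by (auto simp: I'_def intro: ccontr)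
    have sumI': "(\<Sum>i\<in>I'. f i) = (\<Sum>i\<in>I. f i)" if "\<And>i. b i = 0 \<Longrightarrow> f i = 0" for f :: "'i \<Rightarrow> real"
      using I that by (intro sum.mono_neutral_left) (auto simp: I'_def)
    have "P.indep_vars (\<lambda>_. borel) (\<lambda>i z. b i * restrict z {(i, k)} (i, k)) I'"
      using J0 k by (intro gauss_blocks_indep) (auto simp: disjoint_family_on_def I'_def)
    then have "P.indep_vars (\<lambda>_. borel) (\<lambda>i z. b i * z (i, k)) I'" by simp
    then have "distributed (gauss ?J) lborel (\<lambda>z. \<Sum>i\<in>I'. b i * z (i, k))
        (normal_density (\<Sum>i\<in>I'. 0) (sqrt (\<Sum>i\<in>I'. \<bar>b i\<bar>\<^sup>2)))"
    proof (rule P.sum_indep_normal[OF I'])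
      fix i assume i: "i \<in> I'"
      then show "0 < \<bar>b i\<bar>" by (simp add: I'_def)
      have "distributed (gauss ?J) lborel (\<lambda>z. z (i, k)) std_normal_density"
        using i k by (intro gauss_coordinate_normal) (auto simp: I'_def)
      from P.normal_density_affine[OF this, of "b i" 0] i
      show "distributed (gauss ?J) lborel (\<lambda>z. b i * z (i, k)) (normal_density 0 \<bar>b i\<bar>)"
        by (simp add: I'_def)
    qed
    moreover have "(\<lambda>z. \<Sum>i\<in>I'. b i * z (i, k)) = ?g k" by (intro ext sumI') simp
    moreover have "(\<Sum>i\<in>I'. \<bar>b i\<bar>\<^sup>2) = 1" using b by (subst sumI') auto
    ultimately have "distributed (gauss ?J) lborel (?g k) std_normal_density" by simp
    then have "distr (gauss ?J) lborel (?g k) = std_normal_distribution" by (simp add: distributed_def)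
    moreover have "distr (gauss ?J) lborel (?g k) = distr (gauss ?J) borel (?g k)"
      by (intro distr_cong) auto
    ultimately show ?thesis by simp
  qed
  have rv: "?g k \<in> borel_measurable (gauss ?J)" if "k \<in> {..<q}" for k
    using that by simp
  have "distr (gauss ?J) (PiM {..<q} (\<lambda>_. borel)) (\<lambda>z. \<lambda>k\<in>{..<q}. ?g k z) =
      PiM {..<q} (\<lambda>k. distr (gauss ?J) borel (?g k))"
    using indep q rv by (subst (asm) P.indep_vars_iff_distr_eq_PiM') auto
  also have "\<dots> = gauss {..<q}"
    by (intro PiM_cong) (simp_all add: law)
  also have "distr (gauss ?J) (PiM {..<q} (\<lambda>_. borel)) (\<lambda>z. \<lambda>k\<in>{..<q}. ?g k z) =
      distr (gauss ?J) (gauss {..<q}) (\<lambda>z. \<lambda>k\<in>{..<q}. ?g k z)"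
    by (intro distr_cong) (auto simp: sets_gauss)
  finally show ?thesis .
qed

lemma chi_square_from_linear_forms:
  fixes I :: "'i set" and b :: "'i \<Rightarrow> real"
  assumes I: "finite I" and b: "(\<Sum>i\<in>I. (b i)\<^sup>2) = 1" and q: "q > 0"
  shows "distr (gauss (I \<times> {..<q})) borel (\<lambda>z. \<Sum>k<q. (\<Sum>i\<in>I. b i * z (i, k))\<^sup>2) = chi_square q"
proof -
  have "chi_square q = distr (distr (gauss (I \<times> {..<q})) (gauss {..<q})
      (\<lambda>z. \<lambda>k\<in>{..<q}. \<Sum>i\<in>I. b i * z (i, k))) borel (\<lambda>z. \<Sum>k<q. (z k)\<^sup>2)"
    by (simp add: chi_square_def gauss_linear_forms[OF assms])
  also have "\<dots> = distr (gauss (I \<times> {..<q})) borel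
      ((\<lambda>z. \<Sum>k<q. (z k)\<^sup>2) \<circ> (\<lambda>z. \<lambda>k\<in>{..<q}. \<Sum>i\<in>I. b i * z (i, k)))"
    by (intro distr_distr) (auto intro!: measurable_restrict)
  also have "(\<lambda>z. \<Sum>k<q. (z k)\<^sup>2) \<circ> (\<lambda>z. \<lambda>k\<in>{..<q}. \<Sum>i\<in>I. b i * z (i, k)) =
      (\<lambda>z. \<Sum>k<q. (\<Sum>i\<in>I. b i * z (i, k))\<^sup>2)"
    by (auto intro!: ext sum.cong)
  finally show ?thesis by simp
qed

lemma polynomial_in_mono: "polynomial_in J f \<Longrightarrow> J \<subseteq> J' \<Longrightarrow> polynomial_in J' f"
  by (induction rule: polynomial_in.induct) (auto intro: polynomial_in.intros)

text \<open>
The coefficients \<open>a i\<close> are functions of the last column only. Conditionally on that column they are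
constants, and after normalization the other columns yield a chi-square variable whose law does not
depend on the column; hence the unconditional law is the same. The point \<open>w\<close> serves to show that the
normalization is almost surely possible.
\<close>
lemma chi_square_self_normalized:
  fixes I :: "'i set" and a :: "'i \<Rightarrow> ('i \<times> nat \<Rightarrow> real) \<Rightarrow> real"
  assumes I: "finite I" and q: "q > 0"
    and a_poly: "\<And>i. i \<in> I \<Longrightarrow> polynomial_in (I \<times> {q}) (a i)"
    and a_dep: "\<And>i z z'. i \<in> I \<Longrightarrow> (\<And>i'. i' \<in> I \<Longrightarrow> z (i', q) = z' (i', q)) \<Longrightarrow> a i z = a i z'"
    and w: "w \<in> extensional (I \<times> {q})" "(\<Sum>i\<in>I. (a i w)\<^sup>2) \<noteq> 0"
  shows "distr (gauss (I \<times> {..q})) borel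
      (\<lambda>z. (\<Sum>k<q. (\<Sum>i\<in>I. a i z * z (i, k))\<^sup>2) / (\<Sum>i\<in>I. (a i z)\<^sup>2)) = chi_square q"
    (is "distr _ borel ?T = _")
proof (rule measure_eqI)
  show "sets (distr (gauss (I \<times> {..q})) borel ?T) = sets (chi_square q)"
    by (simp add: chi_square_def)
  let ?J1 = "I \<times> {q}" and ?J2 = "I \<times> {..<q}"
  interpret G: product_sigma_finite "\<lambda>_. std_normal_distribution" by (rule product_sigma_finite_gauss)
  interpret P1: prob_space "gauss ?J1" by (rule prob_space_gauss)
  have J: "I \<times> {..q} = ?J1 \<union> ?J2" by auto
  have a_poly': "polynomial_in (I \<times> {..q}) (a i)" if "i \<in> I" for i
    by (rule polynomial_in_mono[OF a_poly[OF that]]) auto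
  have a_meas[measurable]: "a i \<in> borel_measurable (PiM (I \<times> {..q}) (\<lambda>_. borel))" if "i \<in> I" for i
    by (rule polynomial_in_measurable[OF a_poly'[OF that]]) simp
  have T: "?T \<in> borel_measurable (PiM (I \<times> {..q}) (\<lambda>_. borel))" by measurable
  fix B assume "B \<in> sets (distr (gauss (I \<times> {..q})) borel ?T)"
  then have B[measurable]: "B \<in> sets borel" by simp
  define E where "E = ?T -` B \<inter> space (gauss (?J1 \<union> ?J2))"
  have E: "E \<in> sets (gauss (?J1 \<union> ?J2))"
    unfolding E_def J[symmetric] using T B by (intro measurable_sets[of _ _ borel]) simp_all
  have nz: "AE x in gauss ?J1. (\<Sum>i\<in>I. (a i x)\<^sup>2) \<noteq> 0"
    using I w by (intro AE_gauss_polynomial_nonzero) (auto intro!: polynomial_in_intros a_poly)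
  have "emeasure (distr (gauss (I \<times> {..q})) borel ?T) B = emeasure (gauss (?J1 \<union> ?J2)) E"
    using T by (simp add: emeasure_distr E_def J)
  also have "\<dots> = (\<integral>\<^sup>+x. emeasure (gauss ?J2) ((\<lambda>y. merge ?J1 ?J2 (x, y)) -` E \<inter> space (gauss ?J2)) \<partial>gauss ?J1)"
    using E I by (intro G.emeasure_fold_integral) auto
  also have "\<dots> = (\<integral>\<^sup>+x. emeasure (chi_square q) B \<partial>gauss ?J1)"
  proof (rule nn_integral_cong_AE, use nz AE_space in eventually_elim)
    fix x assume x: "(\<Sum>i\<in>I. (a i x)\<^sup>2) \<noteq> 0" and x_space: "x \<in> space (gauss ?J1)"
    have pos: "(\<Sum>i\<in>I. (a i x)\<^sup>2) > 0" using x by (metis less_eq_real_def sum_nonneg zero_le_power2)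
    define b where "b i = a i x / sqrt (\<Sum>i\<in>I. (a i x)\<^sup>2)" for i
    have b: "(\<Sum>i\<in>I. (b i)\<^sup>2) = 1"
      using pos by (simp add: b_def power_divide flip: sum_divide_distrib)
    have Tm: "?T (merge ?J1 ?J2 (x, y)) = (\<Sum>k<q. (\<Sum>i\<in>I. b i * y (i, k))\<^sup>2)" for y
    proof -
      have am: "a i (merge ?J1 ?J2 (x, y)) = a i x" if "i \<in> I" for i
        by (rule a_dep[OF that]) (simp add: merge_def)
      have ym: "merge ?J1 ?J2 (x, y) (i, k) = y (i, k)" if "i \<in> I" "k < q" for i k
        using that by (simp add: merge_def)
      have "?T (merge ?J1 ?J2 (x, y)) = (\<Sum>k<q. (\<Sum>i\<in>I. a i x * y (i, k))\<^sup>2) / (\<Sum>i\<in>I. (a i x)\<^sup>2)"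
        using am ym by simp
      also have "\<dots> = (\<Sum>k<q. ((\<Sum>i\<in>I. a i x * y (i, k)) / sqrt (\<Sum>i\<in>I. (a i x)\<^sup>2))\<^sup>2)"
        by (simp only: power_divide real_sqrt_pow2[OF less_imp_le[OF pos]] sum_divide_distrib[symmetric])
      finally show ?thesis by (simp add: b_def sum_divide_distrib)
    qed
    have "(\<lambda>y. merge ?J1 ?J2 (x, y)) -` E \<inter> space (gauss ?J2) =
        (\<lambda>y. \<Sum>k<q. (\<Sum>i\<in>I. b i * y (i, k))\<^sup>2) -` B \<inter> space (gauss ?J2)"
    proof -
      have "merge ?J1 ?J2 (x, y) \<in> E \<longleftrightarrow> ?T (merge ?J1 ?J2 (x, y)) \<in> B" if "y \<in> space (gauss ?J2)" for y
        using x_space that by (auto simp: E_def space_PiM)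
      then show ?thesis unfolding Tm by auto
    qed
    then have "emeasure (gauss ?J2) ((\<lambda>y. merge ?J1 ?J2 (x, y)) -` E \<inter> space (gauss ?J2)) =
        emeasure (distr (gauss ?J2) borel (\<lambda>y. \<Sum>k<q. (\<Sum>i\<in>I. b i * y (i, k))\<^sup>2)) B"
      by (subst emeasure_distr) simp_all
    then show "emeasure (gauss ?J2) ((\<lambda>y. merge ?J1 ?J2 (x, y)) -` E \<inter> space (gauss ?J2)) = emeasure (chi_square q) B"
      by (simp add: chi_square_from_linear_forms[OF I b q])
  qed
  also have "\<dots> = emeasure (chi_square q) B"
    using P1.emeasure_space_1 by simp
  finally show "emeasure (distr (gauss (I \<times> {..q})) borel ?T) B = emeasure (chi_square q) B" .
qed

text \<open>
The level set of a nonconstant polynomial is null; at \<open>w\<close> the sum of squares is \<open>\<bar>c\<bar> + 1 \<noteq> c\<close>.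
\<close>
lemma chi_square_singleton:
  assumes "q > 0"
  shows "measure (chi_square q) {c} = 0"
proof -
  define f where "f = (\<lambda>z :: nat \<Rightarrow> real. (\<Sum>k<q. (z k)\<^sup>2) - c)"
  define w where "w = (\<lambda>k\<in>{..<q}. if k = 0 then sqrt (\<bar>c\<bar> + 1) else 0 :: real)"
  have "(\<Sum>k<q. (w k)\<^sup>2) = (\<Sum>k<q. if k = 0 then \<bar>c\<bar> + 1 else 0)"
    by (intro sum.cong) (auto simp: w_def)
  then have "f w \<noteq> 0" using assms by (simp add: f_def)
  then have "AE z in gauss {..<q}. f z \<noteq> 0"
    by (intro AE_gauss_polynomial_nonzero[where w = w])
      (auto simp: f_def w_def intro!: polynomial_in_intros)
  then have "AE x in chi_square q. x \<noteq> c"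
    unfolding chi_square_def by (subst AE_distr_iff) (auto simp: f_def)
  then have "emeasure (chi_square q) {c} = 0"
    by (subst (asm) AE_iff_measurable[of "{c}"]) (auto simp: chi_square_def)
  then show ?thesis by (simp add: measure_def)
qed

lemma real_distribution_chi_square: "real_distribution (chi_square q)"
  unfolding chi_square_def
  by (intro prob_space.real_distribution_distr prob_space_gauss) simp

section \<open>Gaussian coordinates of the sample\<close>

text \<open>
In standardized frame coordinates the whole sample is a family of independent standard normal
variables, whatever the strength of the spike.
\<close>
lemma spiked_array_law:
  fixes X :: "nat \<Rightarrow> 'a \<Rightarrow> real ^ 'p"
  assumes M: "prob_space M" and e: "frame \<theta> e" and \<rho>: "s * v \<ge> 0" and n: "n \<ge> 1"
    and indep: "prob_space.indep_vars M (\<lambda>_. borel) X {1..n}"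
    and X: "\<And>i. i \<in> {1..n} \<Longrightarrow> distributed M lborel (X i) (\<lambda>x. ennreal (mvn_density 0 (spiked_cov \<theta> s v) x))"
  defines "J \<equiv> {1..n} \<times> {..<CARD('p)}"
    and "Z \<equiv> (\<lambda>\<omega>. \<lambda>j\<in>{1..n} \<times> {..<CARD('p)}. e (snd j) \<bullet> X (fst j) \<omega> / spike_scale CARD('p) (s * v) (snd j))"
  shows "Z \<in> measurable M (PiM J (\<lambda>_. borel))" "distr M (gauss J) Z = gauss J"
proof -
  interpret prob_space M by fact
  interpret G: product_sigma_finite "\<lambda>_. std_normal_distribution" by (rule product_sigma_finite_gauss)
  let ?p = "CARD('p)" and ?c = "spike_scale CARD('p) (s * v)"
  have rv[measurable]: "X i \<in> borel_measurable M" if "i \<in> {1..n}" for i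
    using X[OF that] by (auto simp: distributed_def)
  show Z: "Z \<in> measurable M (PiM J (\<lambda>_. borel))"
    unfolding Z_def J_def by (intro measurable_restrict) auto
  show "distr M (gauss J) Z = gauss J"
  proof (rule G.PiM_eqI)
    show "finite J" by (simp add: J_def)
    show "sets (distr M (gauss J) Z) = sets (gauss J)" by simp
    fix A :: "nat \<times> nat \<Rightarrow> real set" assume A: "\<And>j. j \<in> J \<Longrightarrow> A j \<in> sets std_normal_distribution"
    define A' where "A' i k = (if (i, k) \<in> J then A (i, k) else UNIV)" for i k
    have A'[measurable]: "A' i k \<in> sets borel" for i k using A[of "(i, k)"] by (auto simp: A'_def)
    define B where "B i = {x. \<forall>k<?p. e k \<bullet> x / ?c k \<in> A' i k}" for i
    have B: "B i \<in> sets borel" for i unfolding B_def by measurable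
    have AJ: "PiE J A \<in> sets (gauss J)"
      using A by (intro sets_PiM_I_finite) (auto simp: J_def)
    have pre: "Z -` PiE J A \<inter> space M = (\<Inter>i\<in>{1..n}. X i -` B i \<inter> space M)"
      using n by (auto simp: Z_def J_def B_def A'_def PiE_iff)
    have "emeasure (distr M (gauss J) Z) (PiE J A) = emeasure M (\<Inter>i\<in>{1..n}. X i -` B i \<inter> space M)"
      using Z AJ by (simp add: emeasure_distr pre)
    also have "\<dots> = (\<Prod>i\<in>{1..n}. emeasure M (X i -` B i \<inter> space M))"
      using indep_varsD_finite[OF indep, of B] n B
      by (simp add: emeasure_eq_measure prod_ennreal)
    also have "\<dots> = (\<Prod>i\<in>{1..n}. \<Prod>k<?p. emeasure std_normal_distribution (A' i k))"
    proof (rule prod.cong[OF refl])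
      fix i assume i: "i \<in> {1..n}"
      have "X i -` B i \<inter> space M = {\<omega> \<in> space M. \<forall>k<?p. e k \<bullet> X i \<omega> / ?c k \<in> A' i k}"
        by (auto simp: B_def)
      then show "emeasure M (X i -` B i \<inter> space M) = (\<Prod>k<?p. emeasure std_normal_distribution (A' i k))"
        using spiked_normal_coordinates[OF M e \<rho> X[OF i], of "A' i"] by simp
    qed
    also have "\<dots> = (\<Prod>(i, k)\<in>{1..n} \<times> {..<?p}. emeasure std_normal_distribution (A' i k))"
      by (rule prod.cartesian_product)
    also have "\<dots> = (\<Prod>j\<in>J. emeasure std_normal_distribution (A j))"
      by (intro prod.cong) (auto simp: J_def A'_def)
    finally show "emeasure (distr M (gauss J) Z) (PiE J A) = (\<Prod>j\<in>J. emeasure std_normal_distribution (A j))" .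
  qed
qed

text \<open>
The sample with prescribed standardized frame coordinates.
\<close>
definition frame_rows :: "(nat \<Rightarrow> real ^ 'p) \<Rightarrow> (nat \<Rightarrow> real) \<Rightarrow> (nat \<times> nat \<Rightarrow> real) \<Rightarrow> nat \<Rightarrow> real ^ 'p" where
  "frame_rows e c z i = (\<Sum>k<CARD('p). (c k * z (i, k)) *\<^sub>R e k)"

lemma sample_cov_cong:
  assumes "\<And>i. i \<in> {1..n} \<Longrightarrow> x i = y i"
  shows "sample_cov n x = sample_cov n y"
  using assms by (simp add: sample_cov_def sample_mean_def)

lemma frame_rows_of_coordinates:
  fixes e :: "nat \<Rightarrow> real ^ 'p"
  assumes e: "frame \<theta> e" and c: "\<And>k. c k \<noteq> 0" and i: "i \<in> {1..n}"
  shows "frame_rows e c (\<lambda>j\<in>{1..n} \<times> {..<CARD('p)}. e (snd j) \<bullet> x (fst j) / c (snd j)) i = x i"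
proof -
  have "frame_rows e c (\<lambda>j\<in>{1..n} \<times> {..<CARD('p)}. e (snd j) \<bullet> x (fst j) / c (snd j)) i =
      (\<Sum>k<CARD('p). (e k \<bullet> x i) *\<^sub>R e k)"
    unfolding frame_rows_def using c i by (intro sum.cong) auto
  also have "\<dots> = x i"
    using e by (intro orthonormal_expand) (auto simp: frame_def)
  finally show ?thesis .
qed

text \<open>
The Krylov determinant of the sample covariance matrix is a polynomial in the coordinates, and \<open>w\<close> is the
coordinate vector of the sample from \<open>cyclic_sample_exists\<close>, at which it does not vanish.
\<close>
lemma AE_cyclic_sample_cov:
  fixes e :: "nat \<Rightarrow> real ^ 'p"
  assumes e: "frame \<theta> e" and c: "\<And>k. c k \<noteq> 0" and n: "2 * CARD('p) \<le> n"
  shows "AE z in gauss ({1..n} \<times> {..<CARD('p)}). cyclic_vector (sample_cov n (frame_rows e c z)) \<theta>"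
proof -
  let ?J = "{1..n} \<times> {..<CARD('p)}"
  obtain \<iota> where \<iota>: "bij_betw \<iota> (UNIV :: 'p set) {..<CARD('p)}"
    by (metis finite_class.finite_UNIV ex_bij_betw_finite_nat atLeast0LessThan)
  obtain x where x: "cyclic_vector (sample_cov n x) (e (CARD('p) - 1))"
    using cyclic_sample_exists[OF _ n, of e] e by (auto simp: frame_def)
  define w where "w = (\<lambda>j\<in>?J. e (snd j) \<bullet> x (fst j) / c (snd j))"
  have "sample_cov n (frame_rows e c w) = sample_cov n x"
    unfolding w_def by (intro sample_cov_cong frame_rows_of_coordinates[OF e c])
  then have "cyclic_vector (sample_cov n (frame_rows e c w)) \<theta>"
    using x e by (simp add: frame_def)
  then have "AE z in gauss ?J. det (\<chi> i. (((*v) (sample_cov n (frame_rows e c z))) ^^ \<iota> i) \<theta>) \<noteq> 0"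
    by (intro AE_gauss_polynomial_nonzero[where w = w] polynomial_in_krylov_det)
      (auto simp: w_def frame_rows_def cyclic_vector_iff_det[OF \<iota>] intro!: polynomial_in_intros)
  then show ?thesis by (simp add: cyclic_vector_iff_det[OF \<iota>])
qed

section \<open>The exact law\<close>

definition coord_mean :: "nat \<Rightarrow> (nat \<times> nat \<Rightarrow> real) \<Rightarrow> nat \<Rightarrow> real" where
  "coord_mean n z k = (\<Sum>i = 1..n. z (i, k)) / real n"

lemma sample_cov_bilinear:
  "x \<bullet> (sample_cov n X *v y) =
     (\<Sum>i = 1..n. ((X i - sample_mean n X) \<bullet> x) * ((X i - sample_mean n X) \<bullet> y)) / real n"
  by (simp add: sample_cov_mult_vec inner_sum_right sum_divide_distrib inner_commute mult.commute)

lemma centered_row_coordinate: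
  fixes e :: "nat \<Rightarrow> real ^ 'p"
  assumes e: "frame \<theta> e" and k: "k < CARD('p)"
  shows "(frame_rows e c z i - sample_mean n (frame_rows e c z)) \<bullet> e k = c k * (z (i, k) - coord_mean n z k)"
proof -
  have row: "frame_rows e c z i \<bullet> e k = c k * z (i, k)" for i
  proof -
    have "frame_rows e c z i \<bullet> e k = (\<Sum>l<CARD('p). c l * z (i, l) * (if l = k then 1 else 0))"
      unfolding frame_rows_def inner_sum_left using e k by (intro sum.cong) (auto simp: frame_def)
    then show ?thesis using k by (simp add: if_distrib cong: if_cong)
  qed
  have "sample_mean n (frame_rows e c z) \<bullet> e k = c k * coord_mean n z k"
    by (simp add: sample_mean_def inner_sum_left row coord_mean_def flip: sum_distrib_left)
  then show ?thesis by (simp add: inner_diff_left row algebra_simps)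
qed

text \<open>
The centred last column \<open>a\<close> sums to zero, so the other columns need not be centred, and the scale
\<open>1 + \<rho>\<close> cancels in the quotient. The identity also covers \<open>a = 0\<close>, where both sides are \<open>x / 0 = 0\<close>.
\<close>
lemma exact_statistic_coordinates:
  fixes e :: "nat \<Rightarrow> real ^ 'p"
  assumes p: "CARD('p) \<ge> 2" and e: "frame \<theta> e" and \<rho>: "\<rho> \<ge> 0" and n: "n \<ge> 1"
  defines "a \<equiv> \<lambda>i z. z (i, CARD('p) - 1) - coord_mean n z (CARD('p) - 1)"
  shows "exact_statistic \<theta> n (sample_cov n (frame_rows e (spike_scale CARD('p) \<rho>) z)) =
    (\<Sum>k<CARD('p) - 1. (\<Sum>i = 1..n. a i z * z (i, k))\<^sup>2) / (\<Sum>i = 1..n. (a i z)\<^sup>2)"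
proof -
  let ?q = "CARD('p) - 1" and ?c = "spike_scale CARD('p) \<rho>"
  let ?S = "sample_cov n (frame_rows e ?c z)"
  define D where "D = (\<Sum>i = 1..n. (a i z)\<^sup>2)"
  define F where "F k = (\<Sum>i = 1..n. a i z * z (i, k))" for k
  have n0: "real n > 0" using n by simp
  have q: "?q < CARD('p)" by simp
  have \<theta>: "\<theta> = e ?q" using e by (simp add: frame_def)
  have cq: "(?c ?q)\<^sup>2 = 1 + \<rho>" using \<rho> by (simp add: spike_scale_def)
  have c1: "?c k = 1" if "k < ?q" for k using that by (simp add: spike_scale_def)
  have a0: "(\<Sum>i = 1..n. a i z) = 0"
    using n0 by (simp add: a_def sum_subtractf coord_mean_def)
  have s: "\<theta> \<bullet> (?S *v \<theta>) = (1 + \<rho>) * D / real n"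
    unfolding sample_cov_bilinear \<theta> centered_row_coordinate[OF e q]
    by (simp add: D_def a_def power2_eq_square mult_ac sum_distrib_left flip: cq)
  have ek: "e k \<bullet> (?S *v \<theta>) = ?c ?q * F k / real n" if k: "k < ?q" for k
  proof -
    have kp: "k < CARD('p)" using k by simp
    have "e k \<bullet> (?S *v \<theta>) = (\<Sum>i = 1..n. ?c ?q * (a i z * z (i, k) - coord_mean n z k * a i z)) / real n"
      unfolding sample_cov_bilinear \<theta> centered_row_coordinate[OF e q] centered_row_coordinate[OF e kp]
      using c1[OF k] by (intro arg_cong2[where f = "(/)"] sum.cong refl) (simp add: a_def algebra_simps)
    also have "\<dots> = ?c ?q * F k / real n"
      using a0 by (simp add: F_def sum_subtractf flip: sum_distrib_left)
    finally show ?thesis .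
  qed
  have "(?S *v \<theta>) \<bullet> (?S *v \<theta>) = (\<Sum>k<CARD('p). (e k \<bullet> (?S *v \<theta>))\<^sup>2)"
    using orthonormal_parseval[of "{..<CARD('p)}" e "?S *v \<theta>" "?S *v \<theta>"] e
    by (simp add: frame_def power2_eq_square)
  also have "{..<CARD('p)} = insert ?q {..<?q}" by auto
  also have "(\<Sum>k\<in>\<dots>. (e k \<bullet> (?S *v \<theta>))\<^sup>2) = (\<theta> \<bullet> (?S *v \<theta>))\<^sup>2 + (\<Sum>k<?q. (e k \<bullet> (?S *v \<theta>))\<^sup>2)"
    by (simp add: \<theta>)
  also have "(\<Sum>k<?q. (e k \<bullet> (?S *v \<theta>))\<^sup>2) = (\<Sum>k<?q. (1 + \<rho>) / (real n)\<^sup>2 * (F k)\<^sup>2)"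
    by (intro sum.cong) (auto simp: ek power_mult_distrib power_divide simp flip: cq)
  finally have W: "(?S *v \<theta>) \<bullet> (?S *v \<theta>) - (\<theta> \<bullet> (?S *v \<theta>))\<^sup>2 = (1 + \<rho>) / (real n)\<^sup>2 * (\<Sum>k<?q. (F k)\<^sup>2)"
    by (simp add: sum_distrib_left)
  have "exact_statistic \<theta> n ?S =
      real n * ((1 + \<rho>) / (real n)\<^sup>2 * (\<Sum>k<?q. (F k)\<^sup>2)) / ((1 + \<rho>) * D / real n)"
    unfolding exact_statistic_def W by (simp only: s)
  also have "\<dots> = (\<Sum>k<?q. (F k)\<^sup>2) / D"
    using n0 \<rho> by (simp add: power2_eq_square)
  finally have "exact_statistic \<theta> n ?S = (\<Sum>k<?q. (F k)\<^sup>2) / D" .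
  then show ?thesis by (simp add: D_def F_def)
qed

lemma exact_statistic_law:
  fixes e :: "nat \<Rightarrow> real ^ 'p"
  assumes p: "CARD('p) \<ge> 2" and e: "frame \<theta> e" and \<rho>: "\<rho> \<ge> 0" and n: "n \<ge> 2"
  shows "distr (gauss ({1..n} \<times> {..<CARD('p)})) borel
      (\<lambda>z. exact_statistic \<theta> n (sample_cov n (frame_rows e (spike_scale CARD('p) \<rho>) z))) =
    chi_square (CARD('p) - 1)"
proof -
  let ?q = "CARD('p) - 1"
  have q: "?q > 0" using p by simp
  have "1 \<le> n" using n by simp
  note T = exact_statistic_coordinates[OF p e \<rho> this]
  have J: "{..<CARD('p)} = {..?q}" using p by auto
  define w where "w = (\<lambda>j\<in>{1..n} \<times> {?q}. if fst j = 1 then 1 else 0 :: real)"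
  have "(\<Sum>i = 1..n. w (i, ?q)) = (\<Sum>i = 1..n. if i = 1 then 1 else 0)"
    by (intro sum.cong) (auto simp: w_def)
  then have "coord_mean n w ?q = 1 / n" using n by (simp add: coord_mean_def)
  then have "(w (1, ?q) - coord_mean n w ?q)\<^sup>2 > 0" using n by (simp add: w_def)
  then have "(\<Sum>i = 1..n. (w (i, ?q) - coord_mean n w ?q)\<^sup>2) > 0"
    using n by (intro sum_pos2[of _ 1]) auto
  then show ?thesis
    unfolding T unfolding J
    by (intro chi_square_self_normalized[where w = w] q)
      (auto simp: w_def coord_mean_def intro!: polynomial_in_intros)
qed

section \<open>Concentration of the sample covariance matrix\<close>

text \<open>
Chebyshev's inequality for the average. By independence the second moments of the centred summands
add up, and each of them is at most the uncentred second moment, for which \<open>B\<close> is a bound.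
\<close>
lemma (in prob_space) weak_law_bound:
  fixes U :: "'i \<Rightarrow> 'a \<Rightarrow> real" and \<delta> :: real
  assumes I: "finite I" "I \<noteq> {}" and indep: "indep_vars (\<lambda>_. borel) U I"
    and int: "\<And>i. i \<in> I \<Longrightarrow> integrable M (\<lambda>\<omega>. (U i \<omega>)\<^sup>2)"
    and mean: "\<And>i. i \<in> I \<Longrightarrow> expectation (U i) = m"
    and B: "\<And>i. i \<in> I \<Longrightarrow> expectation (\<lambda>\<omega>. (U i \<omega>)\<^sup>2) \<le> B"
    and \<delta>: "\<delta> > 0"
  shows "prob {\<omega> \<in> space M. \<delta> \<le> \<bar>(\<Sum>i\<in>I. U i \<omega>) / card I - m\<bar>} \<le> B / (card I * \<delta>\<^sup>2)"
proof -
  have rv[measurable]: "U i \<in> borel_measurable M" if "i \<in> I" for i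
    using indep that by (auto simp: indep_vars_def)
  define V where "V i \<omega> = U i \<omega> - m" for i \<omega>
  have [measurable]: "V i \<in> borel_measurable M" if "i \<in> I" for i
    unfolding V_def using that by measurable
  have intU: "integrable M (U i)" if "i \<in> I" for i
    by (rule square_integrable_imp_integrable[OF rv[OF that] int[OF that]])
  have intV: "integrable M (V i)" "integrable M (\<lambda>\<omega>. (V i \<omega>)\<^sup>2)" and EV: "expectation (V i) = 0"
    and EV2: "expectation (\<lambda>\<omega>. (V i \<omega>)\<^sup>2) \<le> B" if i: "i \<in> I" for i
  proof -
    show "integrable M (V i)" unfolding V_def using intU[OF i] by simp
    have sq: "(\<lambda>\<omega>. (V i \<omega>)\<^sup>2) = (\<lambda>\<omega>. (U i \<omega>)\<^sup>2 - 2 * m * U i \<omega> + m\<^sup>2)"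
      by (auto simp: V_def power2_eq_square algebra_simps)
    show "integrable M (\<lambda>\<omega>. (V i \<omega>)\<^sup>2)" unfolding sq using intU[OF i] int[OF i] by simp
    show "expectation (V i) = 0"
      unfolding V_def using intU[OF i] mean[OF i] by (simp add: prob_space)
    have "expectation (\<lambda>\<omega>. (V i \<omega>)\<^sup>2) = expectation (\<lambda>\<omega>. (U i \<omega>)\<^sup>2) - m\<^sup>2"
      unfolding sq using intU[OF i] int[OF i] mean[OF i]
      by (simp add: prob_space power2_eq_square)
    also have "\<dots> \<le> B" using B[OF i] by (smt (verit) zero_le_power2)
    finally show "expectation (\<lambda>\<omega>. (V i \<omega>)\<^sup>2) \<le> B" .
  qed
  have indV: "indep_vars (\<lambda>_. borel) V I"
    unfolding V_def by (rule indep_vars_compose2[OF indep]) simp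
  have key: "integrable M (\<lambda>\<omega>. \<Sum>i\<in>K. V i \<omega>) \<and> integrable M (\<lambda>\<omega>. (\<Sum>i\<in>K. V i \<omega>)\<^sup>2) \<and>
      expectation (\<lambda>\<omega>. \<Sum>i\<in>K. V i \<omega>) = 0 \<and> expectation (\<lambda>\<omega>. (\<Sum>i\<in>K. V i \<omega>)\<^sup>2) \<le> card K * B"
    if "finite K" "K \<subseteq> I" for K
    using that
  proof (induction K rule: finite_induct)
    case (insert i K)
    let ?S = "\<lambda>\<omega>. \<Sum>i\<in>K. V i \<omega>"
    have i: "i \<in> I" using insert by auto
    have IH: "integrable M ?S" "integrable M (\<lambda>\<omega>. (?S \<omega>)\<^sup>2)" "expectation ?S = 0"
      "expectation (\<lambda>\<omega>. (?S \<omega>)\<^sup>2) \<le> card K * B"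
      using insert by auto
    have ind: "indep_var borel (V i) borel ?S"
      using insert.hyps indep_vars_subset[OF indV insert.prems] by (rule indep_vars_sum)
    have cross: "integrable M (\<lambda>\<omega>. V i \<omega> * ?S \<omega>)" "expectation (\<lambda>\<omega>. V i \<omega> * ?S \<omega>) = 0"
      using indep_var_integrable[OF ind intV(1)[OF i] IH(1)]
        indep_var_lebesgue_integral[OF ind intV(1)[OF i] IH(1)] EV[OF i] by auto
    have sq: "(\<lambda>\<omega>. (V i \<omega> + ?S \<omega>)\<^sup>2) = (\<lambda>\<omega>. (V i \<omega>)\<^sup>2 + 2 * (V i \<omega> * ?S \<omega>) + (?S \<omega>)\<^sup>2)"
      by (auto simp: power2_eq_square algebra_simps)
    have "expectation (\<lambda>\<omega>. (V i \<omega> + ?S \<omega>)\<^sup>2) \<le> (card K + 1) * B"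
      unfolding sq using cross intV(2)[OF i] IH EV2[OF i] by (simp add: algebra_simps)
    moreover have "integrable M (\<lambda>\<omega>. (V i \<omega> + ?S \<omega>)\<^sup>2)"
      unfolding sq using cross intV(2)[OF i] IH by simp
    ultimately show ?case
      using insert.hyps IH intV(1)[OF i] EV[OF i] by simp
  qed simp
  let ?S = "\<lambda>\<omega>. \<Sum>i\<in>I. V i \<omega>"
  have c: "real (card I) > 0" using I by (simp add: card_gt_0_iff)
  have "{\<omega> \<in> space M. \<delta> \<le> \<bar>(\<Sum>i\<in>I. U i \<omega>) / card I - m\<bar>} =
      {\<omega> \<in> space M. card I * \<delta> \<le> \<bar>?S \<omega> - expectation ?S\<bar>}"
  proof -
    have "(\<Sum>i\<in>I. U i \<omega>) / card I - m = ?S \<omega> / card I" for \<omega>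
      using c by (simp add: V_def sum_subtractf field_simps)
    then show ?thesis
      using c key[OF I(1)] by (simp add: abs_divide pos_le_divide_eq mult.commute)
  qed
  also have "prob \<dots> \<le> variance ?S / (card I * \<delta>)\<^sup>2"
    using key[OF I(1)] c \<delta> by (intro Chebyshev_inequality) auto
  also have "\<dots> \<le> (card I * B) / (card I * \<delta>)\<^sup>2"
    using key[OF I(1)] by (intro divide_right_mono) auto
  also have "\<dots> = B / (card I * \<delta>\<^sup>2)"
    using c by (simp add: power2_eq_square)
  finally show ?thesis .
qed

text \<open>
The event of the weak law of large numbers for the first and second empirical moments.
\<close>
definition concentrated :: "nat \<Rightarrow> nat \<Rightarrow> real \<Rightarrow> (nat \<times> nat \<Rightarrow> real) \<Rightarrow> bool" where
  "concentrated n p \<delta> z \<longleftrightarrow>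
     (\<forall>k<p. \<bar>coord_mean n z k\<bar> < \<delta>) \<and>
     (\<forall>k<p. \<forall>l<p. \<bar>(\<Sum>i = 1..n. z (i, k) * z (i, l)) / real n - (if k = l then 1 else 0)\<bar> < \<delta>)"

lemma gauss_moment:
  assumes "j \<in> J"
  shows "integrable (gauss J) (\<lambda>z. z j ^ k)"
    and "(\<integral>z. z j ^ k \<partial>gauss J) = (\<integral>x. std_normal_density x * x ^ k \<partial>lborel)"
proof -
  note D = gauss_coordinate_normal[OF assms]
  show "integrable (gauss J) (\<lambda>z. z j ^ k)"
    using distributed_integrable[OF D, of "\<lambda>x. x ^ k"] integrable_std_normal_moment[of k] by simp
  show "(\<integral>z. z j ^ k \<partial>gauss J) = (\<integral>x. std_normal_density x * x ^ k \<partial>lborel)"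
    using distributed_integral[OF D, of "\<lambda>x. x ^ k"] by simp
qed

lemma gauss_moments:
  assumes "j \<in> J"
  shows "(\<integral>z. z j \<partial>gauss J) = 0" "(\<integral>z. (z j)\<^sup>2 \<partial>gauss J) = 1" "(\<integral>z. z j ^ 4 \<partial>gauss J) = 3"
  using gauss_moment(2)[OF assms, of 1] gauss_moment(2)[OF assms, of 2] gauss_moment(2)[OF assms, of 4]
    integral_std_normal_moment_odd[of 0] integral_std_normal_moment_even[of 1]
    integral_std_normal_moment_even[of 2]
  by (simp_all add: fact_numeral)

text \<open>
Chebyshev's inequality for each of the \<open>p + p\<^sup>2\<close> averages; the second moments of the averaged variables
are at most \<open>1\<close> and \<open>3\<close>, the latter being the fourth moment of a standard normal variable.
\<close>
lemma prob_not_concentrated: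
  assumes n: "n \<ge> 1" and p: "p \<ge> 1" and \<delta>: "\<delta> > 0"
  defines "J \<equiv> {1..n} \<times> {..<p}"
  shows "measure (gauss J) {z \<in> space (gauss J). \<not> concentrated n p \<delta> z} \<le> 4 * (real p)\<^sup>2 / (real n * \<delta>\<^sup>2)"
proof -
  interpret P: prob_space "gauss J" by (rule prob_space_gauss)
  have "(1, 0) \<in> J" using n p by (simp add: J_def)
  then have J0: "J \<noteq> {}" by blast
  have mem: "(i, k) \<in> J \<longleftrightarrow> i \<in> {1..n} \<and> k < p" for i k by (auto simp: J_def)
  have meas[measurable]: "(\<lambda>z. z (i, k)) \<in> borel_measurable (gauss J)" if "i \<in> {1..n}" "k < p" for i k
    using that by (simp add: mem)
  define A where "A k = {z \<in> space (gauss J). \<delta> \<le> \<bar>(\<Sum>i\<in>{1..n}. z (i, k)) / card {1..n} - 0\<bar>}" for k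
  define B where "B kl = {z \<in> space (gauss J). \<delta> \<le> \<bar>(\<Sum>i\<in>{1..n}. z (i, fst kl) * z (i, snd kl)) / card {1..n}
      - (if fst kl = snd kl then 1 else 0)\<bar>}" for kl
  have A: "A k \<in> sets (gauss J)" "P.prob (A k) \<le> 1 / (real n * \<delta>\<^sup>2)" if k: "k < p" for k
  proof -
    show "A k \<in> sets (gauss J)" unfolding A_def using k by measurable
    have "P.indep_vars (\<lambda>_. borel) (\<lambda>i z. restrict z {(i, k)} (i, k)) {1..n}"
      using k by (intro gauss_blocks_indep J0) (auto simp: disjoint_family_on_def mem)
    then have "P.indep_vars (\<lambda>_. borel) (\<lambda>i z. z (i, k)) {1..n}" by simp
    from P.weak_law_bound[OF _ _ this, of 0 1 \<delta>]
    show "P.prob (A k) \<le> 1 / (real n * \<delta>\<^sup>2)"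
      using n k \<delta> gauss_moment(1)[of _ J 2] gauss_moments[of _ J] by (simp add: A_def mem)
  qed
  have B: "B (k, l) \<in> sets (gauss J)" "P.prob (B (k, l)) \<le> 3 / (real n * \<delta>\<^sup>2)" if k: "k < p" and l: "l < p" for k l
  proof -
    show "B (k, l) \<in> sets (gauss J)" unfolding B_def fst_conv snd_conv using k l by measurable
    have "P.indep_vars (\<lambda>_. borel) (\<lambda>i z. restrict z {(i, k), (i, l)} (i, k) * restrict z {(i, k), (i, l)} (i, l)) {1..n}"
      using k l by (intro gauss_blocks_indep[where Y = "\<lambda>i z. z (i, k) * z (i, l)"] J0)
        (auto simp: disjoint_family_on_def mem)
    then have ind: "P.indep_vars (\<lambda>_. borel) (\<lambda>i z. z (i, k) * z (i, l)) {1..n}" by simp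
    have pt: "((x :: real) * y)\<^sup>2 \<le> (x ^ 4 + y ^ 4) / 2" for x y
      using zero_le_power2[of "x\<^sup>2 - y\<^sup>2"] by (simp add: power2_eq_square power4_eq_xxxx algebra_simps)
    have int: "integrable (gauss J) (\<lambda>z. (z (i, k) * z (i, l))\<^sup>2)"
      and le3: "P.expectation (\<lambda>z. (z (i, k) * z (i, l))\<^sup>2) \<le> 3" if i: "i \<in> {1..n}" for i
    proof -
      have ik: "(i, k) \<in> J" "(i, l) \<in> J" using i k l by (auto simp: mem)
      have bd: "integrable (gauss J) (\<lambda>z. (z (i, k) ^ 4 + z (i, l) ^ 4) / 2)"
        using gauss_moment(1)[OF ik(1), of 4] gauss_moment(1)[OF ik(2), of 4] by simp
      show int: "integrable (gauss J) (\<lambda>z. (z (i, k) * z (i, l))\<^sup>2)"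
        by (rule Bochner_Integration.integrable_bound[OF bd]) (use i k l pt in \<open>auto intro: order_trans\<close>)
      have "P.expectation (\<lambda>z. (z (i, k) * z (i, l))\<^sup>2) \<le> P.expectation (\<lambda>z. (z (i, k) ^ 4 + z (i, l) ^ 4) / 2)"
        by (intro integral_mono int bd pt)
      also have "\<dots> = 3"
        using gauss_moment(1)[OF ik(1), of 4] gauss_moment(1)[OF ik(2), of 4] gauss_moments(3)[OF ik(1)]
          gauss_moments(3)[OF ik(2)] by simp
      finally show "P.expectation (\<lambda>z. (z (i, k) * z (i, l))\<^sup>2) \<le> 3" .
    qed
    have mean: "P.expectation (\<lambda>z. z (i, k) * z (i, l)) = (if k = l then 1 else 0)" if i: "i \<in> {1..n}" for i
    proof (cases "k = l")
      case True
      then show ?thesis using gauss_moments(2)[of "(i, k)" J] i k by (simp add: mem power2_eq_square)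
    next
      case False
      have ik: "(i, k) \<in> J" "(i, l) \<in> J" using i k l by (auto simp: mem)
      have sub: "{(i, k), (i, l)} \<subseteq> J" using ik by auto
      have "P.indep_var borel (\<lambda>z. z (i, k)) borel (\<lambda>z. \<Sum>j\<in>{(i, l)}. z j)"
        using False P.indep_vars_subset[OF gauss_coordinates_indep[OF J0] sub]
        by (intro P.indep_vars_sum[where X = "\<lambda>j z. z j"]) auto
      then have "P.expectation (\<lambda>z. z (i, k) * z (i, l)) = P.expectation (\<lambda>z. z (i, k)) * P.expectation (\<lambda>z. z (i, l))"
        using gauss_moment(1)[OF ik(1), of 1] gauss_moment(1)[OF ik(2), of 1]
        by (intro P.indep_var_lebesgue_integral) simp_all
      then show ?thesis using False gauss_moments(1)[OF ik(1)] by simp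
    qed
    have "P.prob {z \<in> space (gauss J). \<delta> \<le> \<bar>(\<Sum>i\<in>{1..n}. z (i, k) * z (i, l)) / card {1..n} - (if k = l then 1 else 0)\<bar>}
        \<le> 3 / (card {1..n} * \<delta>\<^sup>2)"
      using n by (intro P.weak_law_bound ind int mean le3 \<delta>) auto
    then show "P.prob (B (k, l)) \<le> 3 / (real n * \<delta>\<^sup>2)"
      by (simp add: B_def)
  qed
  let ?D = "{..<p} \<times> {..<p}"
  have UA: "(\<Union>k<p. A k) \<in> P.events" using A(1) by (intro sets.finite_UN) auto
  have UB: "(\<Union>kl\<in>?D. B kl) \<in> P.events" using B(1) by (intro sets.finite_UN) auto
  have "{z \<in> space (gauss J). \<not> concentrated n p \<delta> z} \<subseteq> (\<Union>k<p. A k) \<union> (\<Union>kl\<in>?D. B kl)"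
    by (force simp: concentrated_def A_def B_def coord_mean_def not_less)
  then have "P.prob {z \<in> space (gauss J). \<not> concentrated n p \<delta> z} \<le> P.prob ((\<Union>k<p. A k) \<union> (\<Union>kl\<in>?D. B kl))"
    using UA UB by (intro P.finite_measure_mono sets.Un) auto
  also have "\<dots> \<le> P.prob (\<Union>k<p. A k) + P.prob (\<Union>kl\<in>?D. B kl)"
    by (rule measure_Un_le[OF UA UB])
  also have "\<dots> \<le> (\<Sum>k<p. P.prob (A k)) + (\<Sum>kl\<in>?D. P.prob (B kl))"
    using A(1) B(1) by (intro add_mono P.finite_measure_subadditive_finite) auto
  also have "\<dots> \<le> (\<Sum>k<p. 1 / (real n * \<delta>\<^sup>2)) + (\<Sum>kl\<in>?D. 3 / (real n * \<delta>\<^sup>2))"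
    using A(2) B(2) by (intro add_mono sum_mono) auto
  also have "\<dots> = (real p + 3 * (real p)\<^sup>2) / (real n * \<delta>\<^sup>2)"
    by (simp add: add_divide_distrib power2_eq_square)
  also have "\<dots> \<le> 4 * (real p)\<^sup>2 / (real n * \<delta>\<^sup>2)"
  proof (rule divide_right_mono)
    have "real p * 1 \<le> real p * real p" using p by (intro mult_left_mono) auto
    then show "real p + 3 * (real p)\<^sup>2 \<le> 4 * (real p)\<^sup>2" by (simp add: power2_eq_square)
  qed simp
  finally show ?thesis .
qed

text \<open>
In frame coordinates the difference is a bilinear form with coefficients at most \<open>2 \<delta>\<close> in absolute
value, evaluated at a vector \<open>y\<close> with entries at most \<open>sqrt (1 + \<rho>)\<close>.
\<close>
lemma concentrated_sample_cov_close:
  fixes e :: "nat \<Rightarrow> real ^ 'p"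
  assumes e: "frame \<theta> e" and \<rho>: "\<rho> \<ge> 0" and n: "n \<ge> 1"
    and conc: "concentrated n CARD('p) \<delta> z" and \<delta>: "0 < \<delta>" "\<delta> \<le> 1" and x: "norm x = 1"
  shows "\<bar>x \<bullet> (sample_cov n (frame_rows e (spike_scale CARD('p) \<rho>) z) *v x) - (1 + \<rho> * (\<theta> \<bullet> x)\<^sup>2)\<bar>
    \<le> 2 * (real CARD('p))\<^sup>2 * (1 + \<rho>) * \<delta>"
proof -
  let ?p = "CARD('p)" and ?c = "spike_scale CARD('p) \<rho>"
  let ?X = "frame_rows e ?c z"
  have n0: "real n > 0" using n by simp
  have on: "e i \<bullet> e j = (if i = j then 1 else 0)" if "i < ?p" "j < ?p" for i j
    using e that by (simp add: frame_def)
  define y where "y k = ?c k * (e k \<bullet> x)" for k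
  define G where "G k l = (\<Sum>i = 1..n. (z (i, k) - coord_mean n z k) * (z (i, l) - coord_mean n z l)) / real n" for k l
  have cent: "(?X i - sample_mean n ?X) \<bullet> x = (\<Sum>k<?p. y k * (z (i, k) - coord_mean n z k))" for i
  proof -
    have "(?X i - sample_mean n ?X) \<bullet> x = (\<Sum>k<?p. (e k \<bullet> (?X i - sample_mean n ?X)) * (e k \<bullet> x))"
      using on by (intro orthonormal_parseval[symmetric]) auto
    also have "\<dots> = (\<Sum>k<?p. y k * (z (i, k) - coord_mean n z k))"
      by (intro sum.cong)
        (auto simp: y_def inner_commute[of "e _" "_ - _"] centered_row_coordinate[OF e])
    finally show ?thesis .
  qed
  have "x \<bullet> (sample_cov n ?X *v x) =
      (\<Sum>i = 1..n. \<Sum>k<?p. \<Sum>l<?p. (y k * (z (i, k) - coord_mean n z k)) * (y l * (z (i, l) - coord_mean n z l))) / real n"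
    by (simp only: sample_cov_bilinear cent sum_product)
  also have "\<dots> = (\<Sum>k<?p. \<Sum>l<?p. \<Sum>i = 1..n. (y k * (z (i, k) - coord_mean n z k)) * (y l * (z (i, l) - coord_mean n z l))) / real n"
  proof -
    have swap: "(\<Sum>i = 1..n. \<Sum>k<?p. \<Sum>l<?p. g i k l) = (\<Sum>k<?p. \<Sum>l<?p. \<Sum>i = 1..n. g i k l)"
      for g :: "nat \<Rightarrow> nat \<Rightarrow> nat \<Rightarrow> real"
      unfolding sum.swap[of _ _ "{1..n}"] ..
    show ?thesis by (simp only: swap)
  qed
  also have "\<dots> = (\<Sum>k<?p. \<Sum>l<?p. y k * y l * G k l)"
    unfolding sum_divide_distrib G_def sum_distrib_left
    by (intro sum.cong refl) (simp add: mult_ac)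
  finally have S: "x \<bullet> (sample_cov n ?X *v x) = (\<Sum>k<?p. \<Sum>l<?p. y k * y l * G k l)" .
  have "(\<Sum>k<?p. \<Sum>l<?p. y k * y l * (if k = l then 1 else 0)) = (\<Sum>k<?p. (y k)\<^sup>2)"
    by (intro sum.cong) (auto simp: power2_eq_square if_distrib cong: if_cong)
  also have "\<dots> = 1 + \<rho> * (\<theta> \<bullet> x)\<^sup>2"
  proof -
    have "(\<Sum>k<?p. (y k)\<^sup>2) = (\<Sum>k<?p. (e k \<bullet> x)\<^sup>2 + (if k = ?p - 1 then \<rho> * (\<theta> \<bullet> x)\<^sup>2 else 0))"
      using e \<rho> by (intro sum.cong) (auto simp: y_def spike_scale_def power_mult_distrib frame_def algebra_simps)
    also have "\<dots> = x \<bullet> x + \<rho> * (\<theta> \<bullet> x)\<^sup>2"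
      using orthonormal_parseval[of "{..<?p}" e x x] on by (simp add: sum.distrib power2_eq_square)
    finally show ?thesis using x by (simp add: dot_square_norm)
  qed
  finally have \<Sigma>: "1 + \<rho> * (\<theta> \<bullet> x)\<^sup>2 = (\<Sum>k<?p. \<Sum>l<?p. y k * y l * (if k = l then 1 else 0))" by simp
  have y: "\<bar>y k\<bar> \<le> sqrt (1 + \<rho>)" if k: "k < ?p" for k
  proof -
    have "\<bar>e k \<bullet> x\<bar> \<le> 1"
      using Cauchy_Schwarz_ineq2[of "e k" x] x on[OF k k] by (simp add: norm_eq_1[symmetric])
    moreover have "0 \<le> ?c k" "?c k \<le> sqrt (1 + \<rho>)" using \<rho> by (auto simp: spike_scale_def)
    ultimately have "?c k * \<bar>e k \<bullet> x\<bar> \<le> sqrt (1 + \<rho>) * 1" using \<rho> by (intro mult_mono) auto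
    then show ?thesis using \<open>0 \<le> ?c k\<close> by (simp add: y_def abs_mult)
  qed
  \<comment> \<open>One \<open>\<delta>\<close> comes from the second moment, the other from the product of the two means.\<close>
  have G: "\<bar>G k l - (if k = l then 1 else 0)\<bar> \<le> 2 * \<delta>" if k: "k < ?p" and l: "l < ?p" for k l
  proof -
    have expand: "(\<Sum>i = 1..n. (u i - a) * (w i - b)) =
        (\<Sum>i = 1..n. u i * w i) - b * (\<Sum>i = 1..n. u i) - a * (\<Sum>i = 1..n. w i) + real n * (a * b)"
      for u w :: "nat \<Rightarrow> real" and a b
    proof -
      have "(u i - a) * (w i - b) = u i * w i - b * u i - a * w i + a * b" for i
        by (simp add: algebra_simps)
      then show ?thesis
        by (simp only: sum.distrib sum_subtractf sum_distrib_left[symmetric] sum_constant) simp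
    qed
    have mean: "(\<Sum>i = 1..n. z (i, m)) = real n * coord_mean n z m" for m
      using n0 by (simp add: coord_mean_def)
    have "(\<Sum>i = 1..n. (z (i, k) - coord_mean n z k) * (z (i, l) - coord_mean n z l)) =
        (\<Sum>i = 1..n. z (i, k) * z (i, l)) - real n * (coord_mean n z k * coord_mean n z l)"
      unfolding expand mean by (simp add: mult_ac)
    then have "G k l = (\<Sum>i = 1..n. z (i, k) * z (i, l)) / real n - coord_mean n z k * coord_mean n z l"
      using n0 by (simp add: G_def diff_divide_distrib)
    moreover have "\<bar>coord_mean n z k * coord_mean n z l\<bar> \<le> \<delta> * 1"
      unfolding abs_mult using conc k l \<delta> by (intro mult_mono) (auto simp: concentrated_def intro: less_imp_le order_trans[OF less_imp_le])
    moreover have "\<bar>(\<Sum>i = 1..n. z (i, k) * z (i, l)) / real n - (if k = l then 1 else 0)\<bar> < \<delta>"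
      using conc k l unfolding concentrated_def by blast
    ultimately show ?thesis by linarith
  qed
  have "x \<bullet> (sample_cov n ?X *v x) - (1 + \<rho> * (\<theta> \<bullet> x)\<^sup>2) =
      (\<Sum>k<?p. \<Sum>l<?p. y k * y l * (G k l - (if k = l then 1 else 0)))"
    unfolding S \<Sigma> by (simp only: sum_subtractf[symmetric] right_diff_distrib)
  also have "\<bar>\<dots>\<bar> \<le> (\<Sum>k<?p. \<Sum>l<?p. (1 + \<rho>) * (2 * \<delta>))"
  proof (intro order_trans[OF sum_abs] sum_mono)
    fix k l assume kl: "k \<in> {..<?p}" "l \<in> {..<?p}"
    have "\<bar>y k * y l\<bar> \<le> sqrt (1 + \<rho>) * sqrt (1 + \<rho>)"
      unfolding abs_mult using y kl \<rho> by (intro mult_mono) auto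
    then have "\<bar>y k * y l\<bar> \<le> 1 + \<rho>" using \<rho> by simp
    then show "\<bar>y k * y l * (G k l - (if k = l then 1 else 0))\<bar> \<le> (1 + \<rho>) * (2 * \<delta>)"
      using G[of k l] kl \<rho> unfolding abs_mult[of "y k * y l"] by (intro mult_mono) auto
  qed
  also have "\<dots> = 2 * (real ?p)\<^sup>2 * (1 + \<rho>) * \<delta>"
    by (simp add: power2_eq_square)
  finally show ?thesis .
qed

section \<open>Convergence of distribution functions and quantiles\<close>

text \<open>
If \<open>T n\<close> has a fixed law and the ratio of \<open>Q n\<close> to \<open>T n\<close> tends to \<open>1\<close> in probability, then \<open>Q n\<close>
converges in law to it (a form of Slutsky's lemma). Outside the exceptional event, \<open>Q n \<le> x\<close> implies
\<open>T n \<le> x / (1 - \<eta>)\<close> and is implied by \<open>T n \<le> x / (1 + \<eta>)\<close>.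
\<close>
lemma weak_conv_multiplicative_squeeze:
  fixes M :: "nat \<Rightarrow> 'a measure" and Q T :: "nat \<Rightarrow> 'a \<Rightarrow> real"
  assumes \<nu>: "real_distribution \<nu>"
    and M: "\<And>n. n \<ge> N \<Longrightarrow> prob_space (M n)"
    and Q: "\<And>n. n \<ge> N \<Longrightarrow> Q n \<in> borel_measurable (M n)"
    and T: "\<And>n. n \<ge> N \<Longrightarrow> T n \<in> borel_measurable (M n)"
    and law: "\<And>n. n \<ge> N \<Longrightarrow> distr (M n) borel (T n) = \<nu>"
    and close: "\<And>\<eta>. 0 < \<eta> \<Longrightarrow> \<eta> < 1 \<Longrightarrow>
      (\<lambda>n. measure (M n) {\<omega> \<in> space (M n). \<not> ((1 - \<eta>) * T n \<omega> \<le> Q n \<omega> \<and> Q n \<omega> \<le> (1 + \<eta>) * T n \<omega>)}) \<longlonglongrightarrow> 0"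
  shows "weak_conv_m (\<lambda>n. distr (M n) borel (Q n)) \<nu>"
  unfolding weak_conv_m_def weak_conv_def
proof (intro allI impI LIMSEQ_I)
  interpret \<nu>: real_distribution \<nu> by fact
  fix x \<tau> :: real assume cont: "isCont (cdf \<nu>) x" and \<tau>: "0 < \<tau>"
  have near: "eventually (\<lambda>\<eta>. \<bar>cdf \<nu> (x / (1 + c * \<eta>)) - cdf \<nu> x\<bar> < \<tau> / 2) (at_right 0)" for c :: real
  proof -
    have "((\<lambda>\<eta>. x / (1 + c * \<eta>)) \<longlongrightarrow> x / (1 + c * 0)) (at_right 0)"
      by (intro tendsto_intros) simp
    then have "((\<lambda>\<eta>. cdf \<nu> (x / (1 + c * \<eta>))) \<longlongrightarrow> cdf \<nu> x) (at_right 0)"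
      using isCont_tendsto_compose[OF cont] by simp
    from tendstoD[OF this, of "\<tau> / 2"] show ?thesis using \<tau> by (simp add: dist_real_def)
  qed
  have "eventually (\<lambda>\<eta> :: real. 0 < \<eta> \<and> \<eta> < 1) (at_right 0)"
    using eventually_at_right_real[of 0 1] by (auto elim: eventually_mono)
  then have "eventually (\<lambda>\<eta>. (0 < \<eta> \<and> \<eta> < 1) \<and> \<bar>cdf \<nu> (x / (1 + (-1) * \<eta>)) - cdf \<nu> x\<bar> < \<tau> / 2 \<and>
      \<bar>cdf \<nu> (x / (1 + 1 * \<eta>)) - cdf \<nu> x\<bar> < \<tau> / 2) (at_right 0)"
    by (rule eventually_conj[OF _ eventually_conj[OF near near]])
  then obtain \<eta> where \<eta>: "0 < \<eta>" "\<eta> < 1"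
    and near: "\<bar>cdf \<nu> (x / (1 - \<eta>)) - cdf \<nu> x\<bar> < \<tau> / 2" "\<bar>cdf \<nu> (x / (1 + \<eta>)) - cdf \<nu> x\<bar> < \<tau> / 2"
    using eventually_happens[of _ "at_right (0 :: real)"] by auto
  define bad where "bad n = {\<omega> \<in> space (M n). \<not> ((1 - \<eta>) * T n \<omega> \<le> Q n \<omega> \<and> Q n \<omega> \<le> (1 + \<eta>) * T n \<omega>)}" for n
  obtain N' where N': "\<And>n. n \<ge> N' \<Longrightarrow> measure (M n) (bad n) < \<tau> / 2"
    using LIMSEQ_D[OF close[OF \<eta>], of "\<tau> / 2"] \<tau> by (auto simp: bad_def)
  show "\<exists>no. \<forall>n\<ge>no. norm (cdf (distr (M n) borel (Q n)) x - cdf \<nu> x) < \<tau>"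
  proof (intro exI allI impI)
    fix n assume n: "n \<ge> max N N'"
    then have nN: "n \<ge> N" by simp
    interpret prob_space "M n" by (rule M[OF nN])
    note [measurable] = Q[OF nN] T[OF nN]
    have bad[measurable]: "bad n \<in> sets (M n)" unfolding bad_def by measurable
    have cdfQ: "cdf (distr (M n) borel (Q n)) x = prob {\<omega> \<in> space (M n). Q n \<omega> \<le> x}"
      by (simp add: cdf_def measure_distr vimage_def Int_def conj_commute)
    have cdfT: "cdf \<nu> y = prob {\<omega> \<in> space (M n). T n \<omega> \<le> y}" for y
      unfolding law[OF nN, symmetric] by (simp add: cdf_def measure_distr vimage_def Int_def conj_commute)
    have "prob {\<omega> \<in> space (M n). Q n \<omega> \<le> x} \<le> prob ({\<omega> \<in> space (M n). T n \<omega> \<le> x / (1 - \<eta>)} \<union> bad n)"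
      using \<eta> by (intro finite_measure_mono sets.Un bad) (auto simp: bad_def pos_le_divide_eq mult.commute)
    also have "\<dots> \<le> cdf \<nu> (x / (1 - \<eta>)) + prob (bad n)"
      unfolding cdfT by (intro measure_Un_le bad) measurable
    finally have up: "cdf (distr (M n) borel (Q n)) x \<le> cdf \<nu> (x / (1 - \<eta>)) + prob (bad n)"
      by (simp add: cdfQ)
    have "cdf \<nu> (x / (1 + \<eta>)) \<le> prob ({\<omega> \<in> space (M n). Q n \<omega> \<le> x} \<union> bad n)"
      unfolding cdfT using \<eta> by (intro finite_measure_mono sets.Un bad) (auto simp: bad_def pos_le_divide_eq mult.commute)
    also have "\<dots> \<le> prob {\<omega> \<in> space (M n). Q n \<omega> \<le> x} + prob (bad n)"
      by (intro measure_Un_le bad) measurable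
    finally have low: "cdf \<nu> (x / (1 + \<eta>)) \<le> cdf (distr (M n) borel (Q n)) x + prob (bad n)"
      by (simp add: cdfQ)
    have "prob (bad n) < \<tau> / 2" using N' n by simp
    then show "norm (cdf (distr (M n) borel (Q n)) x - cdf \<nu> x) < \<tau>"
      using up low near unfolding real_norm_def abs_less_iff by linarith
  qed
qed

text \<open>
The distribution function is continuous. Hence the set is closed and contains its infimum, and the
values to the left of the infimum, which are less than \<open>\<beta>\<close>, give the opposite inequality in the limit.
\<close>
lemma cdf_quantile:
  assumes \<nu>: "real_distribution \<nu>" and atomless: "\<And>x. measure \<nu> {x} = 0" and \<beta>: "0 < \<beta>" "\<beta> < 1"
  shows "cdf \<nu> (Inf {x. \<beta> \<le> cdf \<nu> x}) = \<beta>"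
proof -
  interpret real_distribution \<nu> by fact
  have cont: "isCont (cdf \<nu>) x" for x by (simp add: isCont_cdf atomless)
  let ?A = "{x. \<beta> \<le> cdf \<nu> x}"
  have "eventually (\<lambda>x. \<beta> < cdf \<nu> x) at_top"
    using order_tendstoD(1)[OF cdf_lim_at_top_prob \<beta>(2)] .
  then obtain a where "\<beta> < cdf \<nu> a" by (auto simp: eventually_at_top_linorder)
  then have ne: "?A \<noteq> {}" by (auto intro: less_imp_le)
  have "eventually (\<lambda>x. cdf \<nu> x < \<beta>) at_bot"
    using order_tendstoD(2)[OF cdf_lim_at_bot \<beta>(1)] .
  then obtain b where b: "\<And>x. x \<le> b \<Longrightarrow> cdf \<nu> x < \<beta>" by (auto simp: eventually_at_bot_linorder)
  have bdd: "bdd_below ?A"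
  proof (rule bdd_belowI[of _ b])
    fix y assume "y \<in> ?A"
    then show "b \<le> y" using b[of y] by (cases "y \<le> b") auto
  qed
  have "closed ?A"
    by (intro closed_Collect_le continuous_on_const continuous_at_imp_continuous_on ballI cont)
  then have "Inf ?A \<in> ?A" by (rule closed_contains_Inf[OF ne bdd])
  moreover have "cdf \<nu> (Inf ?A) \<le> \<beta>"
  proof (rule tendsto_upperbound)
    show "(cdf \<nu> \<longlongrightarrow> cdf \<nu> (Inf ?A)) (at_left (Inf ?A))"
      using cont[of "Inf ?A"] by (auto simp: isCont_def intro: tendsto_within_subset)
    have "cdf \<nu> x \<le> \<beta>" if "x < Inf ?A" for x
      using cInf_lower[OF _ bdd, of x] that by force
    then show "eventually (\<lambda>x. cdf \<nu> x \<le> \<beta>) (at_left (Inf ?A))"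
      by (auto simp: eventually_at_filter)
  qed simp
  ultimately show ?thesis by simp
qed

section \<open>Asymptotic size of the test\<close>

lemma gs_vec_measurable:
  assumes u: "\<And>j. j \<in> {2..p} \<Longrightarrow> u j \<in> borel_measurable M" and j: "j \<in> {2..p}"
  shows "(\<lambda>\<omega>. gs_vec \<theta> (\<lambda>j. u j \<omega>) j) \<in> borel_measurable M"
  using j
proof (induction j rule: less_induct)
  case (less j)
  have [measurable]: "u j \<in> borel_measurable M" using u less.prems by simp
  have [measurable]: "(\<lambda>\<omega>. gs_vec \<theta> (\<lambda>j. u j \<omega>) k) \<in> borel_measurable M" if "k \<in> {2..<j}" for k
    using less that by auto
  show ?case
    by (subst gs_vec_eq) (simp add: Let_def)
qed

lemma sample_cov_mult_measurable:
  fixes X :: "nat \<Rightarrow> 'a \<Rightarrow> real ^ 'p"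
  assumes [measurable]: "\<And>i. i \<in> {1..n} \<Longrightarrow> X i \<in> borel_measurable M" "y \<in> borel_measurable M"
  shows "(\<lambda>\<omega>. sample_cov n (\<lambda>i. X i \<omega>) *v y \<omega>) \<in> borel_measurable M"
proof -
  have [measurable]: "(\<lambda>\<omega>. sample_mean n (\<lambda>i. X i \<omega>)) \<in> borel_measurable M"
    unfolding sample_mean_def by measurable
  show ?thesis unfolding sample_cov_mult_vec by measurable
qed

text \<open>
The eigenvalues are measurable because they are the quadratic forms of the measurable eigenvectors.
\<close>
lemma Q_HPV_measurable:
  fixes X :: "nat \<Rightarrow> 'a \<Rightarrow> real ^ 'p"
  assumes p: "CARD('p) \<ge> 2" and X: "\<And>i. i \<in> {1..n} \<Longrightarrow> X i \<in> borel_measurable M"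
    and u: "\<And>j. j \<in> {1..CARD('p)} \<Longrightarrow> u j \<in> borel_measurable M"
    and eig: "\<And>j \<omega>. j \<in> {1..CARD('p)} \<Longrightarrow> \<omega> \<in> space M \<Longrightarrow>
      unit_eigenvector (sample_cov n (\<lambda>i. X i \<omega>)) (l j \<omega>) (u j \<omega>)"
  shows "(\<lambda>\<omega>. Q_HPV \<theta> n (sample_cov n (\<lambda>i. X i \<omega>)) (\<lambda>j. l j \<omega>) (\<lambda>j. u j \<omega>)) \<in> borel_measurable M"
proof -
  have l: "l j \<in> borel_measurable M" if j: "j \<in> {1..CARD('p)}" for j
  proof (rule measurable_cong[THEN iffD1])
    show "(\<lambda>\<omega>. u j \<omega> \<bullet> (sample_cov n (\<lambda>i. X i \<omega>) *v u j \<omega>)) \<in> borel_measurable M"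
      using sample_cov_mult_measurable[OF X u[OF j]] u[OF j] by measurable
    fix \<omega> assume "\<omega> \<in> space M"
    from eig[OF j this] show "u j \<omega> \<bullet> (sample_cov n (\<lambda>i. X i \<omega>) *v u j \<omega>) = l j \<omega>"
      by (simp add: unit_eigenvector_def dot_square_norm)
  qed
  have [measurable]: "l j \<in> borel_measurable M" if "j \<in> {2..CARD('p)}" for j using l that by auto
  have [measurable]: "l 1 \<in> borel_measurable M" using l p by auto
  have [measurable]: "(\<lambda>\<omega>. gs_vec \<theta> (\<lambda>j. u j \<omega>) j) \<in> borel_measurable M" if "j \<in> {2..CARD('p)}" for j
    using gs_vec_measurable[of "CARD('p)" u M j \<theta>] u that by auto
  have [measurable]: "(\<lambda>\<omega>. sample_cov n (\<lambda>i. X i \<omega>) *v \<theta>) \<in> borel_measurable M"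
    by (intro sample_cov_mult_measurable X) simp_all
  show ?thesis unfolding Q_HPV_def by measurable
qed

text \<open>
The facts about Gaussian coordinates, stated for one row of the array on its own probability space.
\<close>
lemma spiked_model_transfer:
  fixes X :: "nat \<Rightarrow> 'a \<Rightarrow> real ^ 'p"
  assumes p: "CARD('p) \<ge> 2" and n: "2 * CARD('p) \<le> n" and \<rho>: "s * v \<ge> 0"
    and e: "frame \<theta> e" and M: "prob_space M"
    and indep: "prob_space.indep_vars M (\<lambda>_. borel) X {1..n}"
    and X: "\<And>i. i \<in> {1..n} \<Longrightarrow> distributed M lborel (X i) (\<lambda>x. ennreal (mvn_density 0 (spiked_cov \<theta> s v) x))"
  defines "S \<equiv> \<lambda>\<omega>. sample_cov n (\<lambda>i. X i \<omega>)"
  shows "(\<lambda>\<omega>. exact_statistic \<theta> n (S \<omega>)) \<in> borel_measurable M"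
    and "distr M borel (\<lambda>\<omega>. exact_statistic \<theta> n (S \<omega>)) = chi_square (CARD('p) - 1)"
    and "AE \<omega> in M. cyclic_vector (S \<omega>) \<theta>"
    and "\<And>\<delta>. 0 < \<delta> \<Longrightarrow> \<delta> \<le> 1 \<Longrightarrow> \<exists>B \<in> sets M. measure M B \<le> 4 * (real CARD('p))\<^sup>2 / (real n * \<delta>\<^sup>2) \<and>
      (\<forall>\<omega> \<in> space M - B. \<forall>x. norm x = 1 \<longrightarrow>
        \<bar>x \<bullet> (S \<omega> *v x) - (1 + s * v * (\<theta> \<bullet> x)\<^sup>2)\<bar> \<le> 2 * (real CARD('p))\<^sup>2 * (1 + s * v) * \<delta>)"
proof -
  let ?p = "CARD('p)" and ?c = "spike_scale CARD('p) (s * v)"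
  let ?J = "{1..n} \<times> {..<CARD('p)}"
  interpret prob_space M by fact
  have n2: "n \<ge> 2" and n1: "n \<ge> 1" using n p by auto
  have c: "?c k \<noteq> 0" for k using spike_scale_pos[OF \<rho>, of ?p k] by simp
  define Z where "Z = (\<lambda>\<omega>. \<lambda>j\<in>?J. e (snd j) \<bullet> X (fst j) \<omega> / ?c (snd j))"
  have Zm[measurable]: "Z \<in> measurable M (PiM ?J (\<lambda>_. borel))" and Z: "distr M (gauss ?J) Z = gauss ?J"
    unfolding Z_def using spiked_array_law[OF M e \<rho> n1 indep X] by auto
  have Zg: "Z \<in> measurable M (gauss ?J)" using Zm by simp
  have S: "S \<omega> = sample_cov n (frame_rows e ?c (Z \<omega>))" for \<omega>
    unfolding S_def Z_def
    by (intro sample_cov_cong frame_rows_of_coordinates[OF e c, where x = "\<lambda>i. X i \<omega>", symmetric])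
  define h where "h = (\<lambda>z. exact_statistic \<theta> n (sample_cov n (frame_rows e ?c z)))"
  have hm[measurable]: "h \<in> borel_measurable (PiM ?J (\<lambda>_. borel))"
  proof -
    have [measurable]: "(\<lambda>z. z (i, k)) \<in> borel_measurable (PiM ?J (\<lambda>_. borel))" if "i \<in> {1..n}" "k < ?p" for i k
      using that by simp
    have "?p - 1 < ?p" by simp
    then show ?thesis
      unfolding h_def exact_statistic_coordinates[OF p e \<rho> n1] coord_mean_def by measurable
  qed
  have T: "(\<lambda>\<omega>. exact_statistic \<theta> n (S \<omega>)) = h \<circ> Z" by (auto simp: S h_def)
  show "(\<lambda>\<omega>. exact_statistic \<theta> n (S \<omega>)) \<in> borel_measurable M"
    unfolding T by (rule measurable_comp[OF Zm hm])
  have "distr M borel (h \<circ> Z) = distr (distr M (gauss ?J) Z) borel h"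
    using Zg hm by (intro distr_distr[symmetric]) simp_all
  also have "\<dots> = chi_square (?p - 1)"
    unfolding Z h_def by (rule exact_statistic_law[OF p e \<rho> n2])
  finally show "distr M borel (\<lambda>\<omega>. exact_statistic \<theta> n (S \<omega>)) = chi_square (?p - 1)"
    unfolding T .
  have "AE z in distr M (gauss ?J) Z. cyclic_vector (sample_cov n (frame_rows e ?c z)) \<theta>"
    unfolding Z by (rule AE_cyclic_sample_cov[OF e c n])
  from AE_distrD[OF Zg this] show "AE \<omega> in M. cyclic_vector (S \<omega>) \<theta>" by (simp add: S)
  show "\<exists>B \<in> sets M. measure M B \<le> 4 * (real ?p)\<^sup>2 / (real n * \<delta>\<^sup>2) \<and>
      (\<forall>\<omega> \<in> space M - B. \<forall>x. norm x = 1 \<longrightarrow>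
        \<bar>x \<bullet> (S \<omega> *v x) - (1 + s * v * (\<theta> \<bullet> x)\<^sup>2)\<bar> \<le> 2 * (real ?p)\<^sup>2 * (1 + s * v) * \<delta>)"
    if \<delta>: "0 < \<delta>" "\<delta> \<le> 1" for \<delta>
  proof -
    define E where "E = {z \<in> space (gauss ?J). \<not> concentrated n ?p \<delta> z}"
    have E: "E \<in> sets (gauss ?J)"
    proof -
      have [measurable]: "(\<lambda>z. z (i, k)) \<in> borel_measurable (gauss ?J)" if "i \<in> {1..n}" "k \<in> {..<?p}" for i k
        using that by simp
      have "E = {z \<in> space (gauss ?J). \<not> ((\<forall>k\<in>{..<?p}. \<bar>coord_mean n z k\<bar> < \<delta>) \<and>
          (\<forall>k\<in>{..<?p}. \<forall>l\<in>{..<?p}. \<bar>(\<Sum>i = 1..n. z (i, k) * z (i, l)) / real n - (if k = l then 1 else 0)\<bar> < \<delta>))}"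
        by (simp only: E_def concentrated_def Ball_def lessThan_iff)
      also have "\<dots> \<in> sets (gauss ?J)" unfolding coord_mean_def by measurable
      finally show ?thesis .
    qed
    have "measure M (Z -` E \<inter> space M) = measure (distr M (gauss ?J) Z) E"
      using Zg E by (simp add: measure_distr)
    also have "\<dots> \<le> 4 * (real ?p)\<^sup>2 / (real n * \<delta>\<^sup>2)"
      unfolding Z E_def using p by (intro prob_not_concentrated n1 \<delta>) auto
    finally have le: "measure M (Z -` E \<inter> space M) \<le> 4 * (real ?p)\<^sup>2 / (real n * \<delta>\<^sup>2)" .
    have "concentrated n ?p \<delta> (Z \<omega>)" if "\<omega> \<in> space M - (Z -` E \<inter> space M)" for \<omega>
      using that measurable_space[OF Zg, of \<omega>] by (auto simp: E_def)
    then show ?thesis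
      using le measurable_sets[OF Zg E] concentrated_sample_cov_close[OF e \<rho> n1 _ \<delta>]
      by (intro bexI[of _ "Z -` E \<inter> space M"]) (auto simp: S)
  qed
qed

theorem theorem3p1:
  fixes \<theta>0 :: "real ^ 'p" and v :: real and r :: "nat \<Rightarrow> real"
    and M :: "nat \<Rightarrow> 'a measure"
    and X :: "nat \<Rightarrow> nat \<Rightarrow> 'a \<Rightarrow> real ^ 'p"
    and S :: "nat \<Rightarrow> 'a \<Rightarrow> real ^ 'p ^ 'p"
    and lam :: "nat \<Rightarrow> nat \<Rightarrow> 'a \<Rightarrow> real"
    and th :: "nat \<Rightarrow> nat \<Rightarrow> 'a \<Rightarrow> real ^ 'p"
    and Q :: "nat \<Rightarrow> 'a \<Rightarrow> real"
  assumes p: "CARD('p) \<ge> 2"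
    and \<theta>0: "norm \<theta>0 = 1"
    and v: "v > 0"
    and r_pos: "\<And>n. n \<ge> 1 \<Longrightarrow> r n > 0"
    and r_bdd: "Bseq r"
    and model: "spiked_model \<theta>0 r v M X"
    and S_def: "\<And>n \<omega>. S n \<omega> = sample_cov n (\<lambda>i. X n i \<omega>)"
    and lam: "\<And>n \<omega>. n \<ge> 1 \<Longrightarrow> \<omega> \<in> space (M n) \<Longrightarrow> ordered_eigenvalues (S n \<omega>) (\<lambda>j. lam n j \<omega>)"
    and th: "\<And>n j \<omega>. n \<ge> 1 \<Longrightarrow> j \<in> {1..CARD('p)} \<Longrightarrow> \<omega> \<in> space (M n) \<Longrightarrow>
               unit_eigenvector (S n \<omega>) (lam n j \<omega>) (th n j \<omega>)"
    and th_measurable: "\<And>n j. n \<ge> 1 \<Longrightarrow> j \<in> {1..CARD('p)} \<Longrightarrow> th n j \<in> borel_measurable (M n)"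
    and Q_def: "\<And>n \<omega>. Q n \<omega> = Q_HPV \<theta>0 n (S n \<omega>) (\<lambda>j. lam n j \<omega>) (\<lambda>j. th n j \<omega>)"
  shows "weak_conv_m (\<lambda>n. distr (M n) borel (Q n)) (chi_square (CARD('p) - 1)) \<and>
         ((\<forall>n\<ge>1. r n = 1) \<or>
          (r \<in> o(\<lambda>n. 1) \<and> filterlim (\<lambda>n. sqrt (real n) * r n) at_top sequentially) \<or>
          (\<forall>n\<ge>1. r n = 1 / sqrt (real n)) \<or>
          r \<in> o(\<lambda>n. 1 / sqrt (real n)) \<longrightarrow>
          (\<forall>\<alpha>\<in>{0<..<1}.
             (\<lambda>n. measure (M n)
                {\<omega> \<in> space (M n). Q n \<omega> > chi_square_upper_quantile (CARD('p) - 1) \<alpha>})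
             \<longlonglongrightarrow> \<alpha>))"
proof -
  let ?p = "CARD('p)"
  let ?\<nu> = "chi_square (?p - 1)" and ?N = "2 * ?p"
  obtain e where e: "frame \<theta>0 e" using frame_exists[OF \<theta>0] .
  \<comment> \<open>A bound on the spikes gives one concentration level \<open>\<delta>\<close> that serves all rows at once.\<close>
  obtain R where R: "\<And>n. \<bar>r n\<bar> \<le> R" using r_bdd by (auto simp: Bseq_def)
  have N1: "n \<ge> 1" if "n \<ge> ?N" for n using that p by linarith
  have \<rho>: "0 \<le> r n * v" "r n * v \<le> R * v" if "n \<ge> ?N" for n
    using r_pos[OF N1[OF that]] R[of n] v by (auto intro: mult_right_mono)
  have prob: "prob_space (M n)" if "n \<ge> ?N" for n
    using model N1[OF that] by (auto simp: spiked_model_def)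
  have indep: "prob_space.indep_vars (M n) (\<lambda>_. borel) (X n) {1..n}" if "n \<ge> ?N" for n
    using model N1[OF that] by (auto simp: spiked_model_def)
  have dist: "distributed (M n) lborel (X n i) (\<lambda>x. ennreal (mvn_density 0 (spiked_cov \<theta>0 (r n) v) x))"
    if "n \<ge> ?N" "i \<in> {1..n}" for n i
    using model N1[OF that(1)] that(2) by (auto simp: spiked_model_def)
  note transfer = spiked_model_transfer[OF p _ \<rho>(1) e prob indep dist]
  define T where "T n \<omega> = exact_statistic \<theta>0 n (S n \<omega>)" for n \<omega>
  have T_meas: "T n \<in> borel_measurable (M n)" if "n \<ge> ?N" for n
    using transfer(1)[OF that that that that that] by (simp add: T_def[abs_def] S_def)
  have T_law: "distr (M n) borel (T n) = ?\<nu>" if "n \<ge> ?N" for n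
    using transfer(2)[OF that that that that that] by (simp add: T_def[abs_def] S_def)
  have cyc: "AE \<omega> in M n. cyclic_vector (S n \<omega>) \<theta>0" if "n \<ge> ?N" for n
    using transfer(3)[OF that that that that that] by (simp add: S_def)
  have Q_meas: "Q n \<in> borel_measurable (M n)" if n: "n \<ge> ?N" for n
  proof -
    have "X n i \<in> borel_measurable (M n)" if "i \<in> {1..n}" for i
      using dist[OF n that] by (auto simp: distributed_def)
    moreover have "unit_eigenvector (sample_cov n (\<lambda>i. X n i \<omega>)) (lam n j \<omega>) (th n j \<omega>)"
      if "j \<in> {1..?p}" "\<omega> \<in> space (M n)" for j \<omega>
      using th[OF N1[OF n] that] by (simp add: S_def)
    ultimately have "(\<lambda>\<omega>. Q_HPV \<theta>0 n (sample_cov n (\<lambda>i. X n i \<omega>)) (\<lambda>j. lam n j \<omega>) (\<lambda>j. th n j \<omega>)) \<in> borel_measurable (M n)"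
      using th_measurable[OF N1[OF n]] by (intro Q_HPV_measurable p)
    then show ?thesis by (simp add: Q_def[abs_def] S_def)
  qed
  have close: "(\<lambda>n. measure (M n) {\<omega> \<in> space (M n). \<not> ((1 - \<eta>) * T n \<omega> \<le> Q n \<omega> \<and> Q n \<omega> \<le> (1 + \<eta>) * T n \<omega>)}) \<longlonglongrightarrow> 0"
    if \<eta>: "0 < \<eta>" "\<eta> < 1" for \<eta>
  proof -
    \<comment> \<open>This choice makes the factors \<open>1 / (1 - \<epsilon>)\<close> and \<open>(1 - \<epsilon>) / (1 + \<epsilon>)\<^sup>2\<close> of the sandwich differ from \<open>1\<close>
      by at most \<open>\<eta>\<close>.\<close>
    define \<epsilon> where "\<epsilon> = \<eta> / 4"
    define K where "K = 2 * (real ?p)\<^sup>2 * (1 + R * v)"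
    have "R * v \<ge> 0" using R[of 0] v by auto
    then have K: "K > 0" by (simp add: K_def)
    define \<delta> where "\<delta> = min 1 (\<epsilon> / K)"
    have \<epsilon>: "0 < \<epsilon>" "\<epsilon> < 1" using \<eta> by (auto simp: \<epsilon>_def)
    have \<delta>: "0 < \<delta>" "\<delta> \<le> 1" "K * \<delta> \<le> \<epsilon>"
      using \<epsilon> K by (auto simp: \<delta>_def min_def field_simps)
    have hi: "1 / (1 - \<epsilon>) \<le> 1 + \<eta>"
    proof -
      have "0 \<le> \<eta> * (3 - \<eta>) / 4" using \<eta> by simp
      then have "1 \<le> (1 + \<eta>) * (1 - \<epsilon>)" by (simp add: \<epsilon>_def algebra_simps)
      then show ?thesis using \<epsilon> by (simp add: divide_le_eq)
    qed
    have lo: "1 - \<eta> \<le> (1 - \<epsilon>) / (1 + \<epsilon>)\<^sup>2"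
    proof -
      have "(1 - 4 * \<epsilon>) * (1 + \<epsilon>)\<^sup>2 = (1 - \<epsilon>) - (\<epsilon> + 7 * \<epsilon>\<^sup>2 + 4 * \<epsilon> ^ 3)"
        by (simp add: power2_eq_square power3_eq_cube algebra_simps)
      also have "\<dots> \<le> 1 - \<epsilon>"
        using \<epsilon>(1) zero_less_power[OF \<epsilon>(1), of 2] zero_less_power[OF \<epsilon>(1), of 3] by linarith
      finally show ?thesis using \<epsilon> by (simp add: \<epsilon>_def pos_le_divide_eq)
    qed
    have bound: "measure (M n) {\<omega> \<in> space (M n). \<not> ((1 - \<eta>) * T n \<omega> \<le> Q n \<omega> \<and> Q n \<omega> \<le> (1 + \<eta>) * T n \<omega>)}
        \<le> 4 * (real ?p)\<^sup>2 / \<delta>\<^sup>2 / real n" if n: "n \<ge> ?N" for n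
    proof -
      interpret prob_space "M n" by (rule prob[OF n])
      note [measurable] = Q_meas[OF n] T_meas[OF n]
      define bad where "bad = {\<omega> \<in> space (M n). \<not> ((1 - \<eta>) * T n \<omega> \<le> Q n \<omega> \<and> Q n \<omega> \<le> (1 + \<eta>) * T n \<omega>)}"
      have bad: "bad \<in> sets (M n)" unfolding bad_def by measurable
      obtain B where B: "B \<in> sets (M n)" "prob B \<le> 4 * (real ?p)\<^sup>2 / (real n * \<delta>\<^sup>2)"
        and close: "\<And>\<omega> x. \<omega> \<in> space (M n) - B \<Longrightarrow> norm x = 1 \<Longrightarrow>
          \<bar>x \<bullet> (S n \<omega> *v x) - (1 + r n * v * (\<theta>0 \<bullet> x)\<^sup>2)\<bar> \<le> 2 * (real ?p)\<^sup>2 * (1 + r n * v) * \<delta>"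
        using transfer(4)[OF n n n n n _ \<delta>(1,2)] unfolding S_def[symmetric] by blast
      have "2 * (real ?p)\<^sup>2 * (1 + r n * v) \<le> K"
        unfolding K_def using \<rho>[OF n] by (intro mult_left_mono) auto
      then have le: "2 * (real ?p)\<^sup>2 * (1 + r n * v) * \<delta> \<le> \<epsilon>"
        using \<delta> by (meson less_imp_le mult_right_mono order_trans)
      have "AE \<omega> in M n. \<omega> \<in> bad \<longrightarrow> \<omega> \<in> B"
        using cyc[OF n] AE_space
      proof eventually_elim
        case (elim \<omega>)
        have "\<omega> \<notin> bad" if "\<omega> \<notin> B"
        proof -
          have sym: "transpose (S n \<omega>) = S n \<omega>" by (simp add: S_def transpose_sample_cov)
          have cl: "\<bar>x \<bullet> (S n \<omega> *v x) - (1 + r n * v * (\<theta>0 \<bullet> x)\<^sup>2)\<bar> \<le> \<epsilon>" if "norm x = 1" for x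
            using close[of \<omega> x] le elim \<open>\<omega> \<notin> B\<close> that by force
          note sw = HPV_sandwich[where n = n, OF p \<theta>0 sym elim(1) lam[OF N1[OF n] elim(2)]
              th[OF N1[OF n] _ elim(2)] \<rho>(1)[OF n] less_imp_le[OF \<epsilon>(1)] \<epsilon>(2) cl]
          have "(1 - \<eta>) * T n \<omega> \<le> (1 - \<epsilon>) / (1 + \<epsilon>)\<^sup>2 * T n \<omega>"
            using sw(1) lo unfolding T_def by (intro mult_right_mono)
          also have "\<dots> \<le> Q n \<omega>" using sw(3) unfolding T_def Q_def .
          finally have 1: "(1 - \<eta>) * T n \<omega> \<le> Q n \<omega>" .
          have "Q n \<omega> \<le> 1 / (1 - \<epsilon>) * T n \<omega>" using sw(2) unfolding T_def Q_def by simp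
          also have "\<dots> \<le> (1 + \<eta>) * T n \<omega>"
            using sw(1) hi unfolding T_def by (intro mult_right_mono)
          finally show ?thesis using 1 by (simp add: bad_def)
        qed
        then show ?case by blast
      qed
      then have "prob bad \<le> prob B" by (rule finite_measure_mono_AE[OF _ B(1)])
      also have "\<dots> \<le> 4 * (real ?p)\<^sup>2 / \<delta>\<^sup>2 / real n" using B(2) by (simp add: mult.commute)
      finally show ?thesis unfolding bad_def .
    qed
    have "(\<lambda>n. 4 * (real ?p)\<^sup>2 / \<delta>\<^sup>2 / real n) \<longlonglongrightarrow> 0" by (rule lim_const_over_n)
    then show ?thesis
      by (rule tendsto_sandwich[rotated 2, OF tendsto_const])
        (use bound in \<open>auto intro!: eventually_sequentiallyI[of ?N]\<close>)
  qed
  have weak: "weak_conv_m (\<lambda>n. distr (M n) borel (Q n)) ?\<nu>"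
    by (rule weak_conv_multiplicative_squeeze[where N = ?N, OF real_distribution_chi_square prob Q_meas T_meas T_law close])
  have size: "(\<lambda>n. measure (M n) {\<omega> \<in> space (M n). Q n \<omega> > chi_square_upper_quantile (?p - 1) \<alpha>}) \<longlonglongrightarrow> \<alpha>"
    if \<alpha>: "\<alpha> \<in> {0<..<1}" for \<alpha>
  proof -
    interpret \<nu>: real_distribution ?\<nu> by (rule real_distribution_chi_square)
    have q: "?p - 1 > 0" using p by simp
    define x where "x = chi_square_upper_quantile (?p - 1) \<alpha>"
    have x: "cdf ?\<nu> x = 1 - \<alpha>"
      unfolding x_def chi_square_upper_quantile_def
      using \<alpha> by (intro cdf_quantile real_distribution_chi_square chi_square_singleton q) auto
    have "isCont (cdf ?\<nu>) x" unfolding \<nu>.isCont_cdf by (rule chi_square_singleton[OF q])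
    then have "(\<lambda>n. cdf (distr (M n) borel (Q n)) x) \<longlonglongrightarrow> 1 - \<alpha>"
      using weak x by (auto simp: weak_conv_m_def weak_conv_def)
    then have "(\<lambda>n. 1 - cdf (distr (M n) borel (Q n)) x) \<longlonglongrightarrow> 1 - (1 - \<alpha>)"
      by (intro tendsto_diff tendsto_const)
    moreover have "1 - cdf (distr (M n) borel (Q n)) x = measure (M n) {\<omega> \<in> space (M n). Q n \<omega> > x}" if n: "n \<ge> ?N" for n
    proof -
      interpret prob_space "M n" by (rule prob[OF n])
      note [measurable] = Q_meas[OF n]
      have "cdf (distr (M n) borel (Q n)) x = prob {\<omega> \<in> space (M n). Q n \<omega> \<le> x}"
        by (simp add: cdf_def measure_distr vimage_def Int_def conj_commute)
      moreover have "prob {\<omega> \<in> space (M n). \<not> Q n \<omega> \<le> x} = 1 - prob {\<omega> \<in> space (M n). Q n \<omega> \<le> x}"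
        by (rule prob_neg) measurable
      ultimately show ?thesis by (simp add: not_le)
    qed
    then have "eventually (\<lambda>n. 1 - cdf (distr (M n) borel (Q n)) x =
        measure (M n) {\<omega> \<in> space (M n). Q n \<omega> > x}) sequentially"
      by (intro eventually_sequentiallyI[of ?N])
    ultimately have "(\<lambda>n. measure (M n) {\<omega> \<in> space (M n). Q n \<omega> > x}) \<longlonglongrightarrow> 1 - (1 - \<alpha>)"
      by (rule Lim_transform_eventually)
    then show ?thesis by (simp add: x_def)
  qed
  show ?thesis using weak size by blast
qed

end
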